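(* For every fixed $s\ge 2$, as $n\to\infty$, we have $\mathrm{st}(n,\theta_{s*3})=\Theta(n^{3/2})$, $\mathrm{st}(n,\theta_{s*5})=\Theta(n^{4/3})$, and $\mathrm{st}(n,\theta_{s*9})=\Theta(n^{6/5})$.
   Context: Graphs are finite and simple. For $s\ge 2$ and odd $k\ge 3$, $\theta_{s*k}$ is the graph in which two nonadjacent vertices $u,v$ are connected by $s$ internally disjoint paths of length $k$ (i.e. with $k$ edges each), and with no other vertices or edges. For a non-complete graph $G$ on $r$ vertices and $n\ge r$, $\mathrm{st}(n,G)$ is the largest $m$ for which there is a graph $H$ with $n$ vertices and $m$ edges such that no subgraph $F\subseteq H$ on exactly $r$ vertices contains $G$ as a proper subgraph (subgraphs are not necessarily induced). *)

theory Defs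
  imports Complex_Main "HOL-Library.Landau_Symbols"
begin

record 'a ugraph =
  uverts :: "'a set"
  uedges :: "'a set set"

definition fin_simple_graph :: "'a ugraph \<Rightarrow> bool" where
  "fin_simple_graph G \<longleftrightarrow>
     finite (uverts G) \<and> (\<forall>e\<in>uedges G. e \<subseteq> uverts G \<and> card e = 2)"

text \<open>Subgraphs are not required to be induced.\<close>

definition is_subgraph :: "'a ugraph \<Rightarrow> 'a ugraph \<Rightarrow> bool" where
  "is_subgraph F H \<longleftrightarrow>
     fin_simple_graph F \<and> fin_simple_graph H \<and>
     uverts F \<subseteq> uverts H \<and> uedges F \<subseteq> uedges H"

definition graph_iso :: "'a ugraph \<Rightarrow> 'b ugraph \<Rightarrow> bool" where
  "graph_iso G H \<longleftrightarrow>
     (\<exists>f. bij_betw f (uverts G) (uverts H) \<and> uedges H = (\<lambda>e. f ` e) ` uedges G)"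

definition contains_properly :: "'a ugraph \<Rightarrow> 'b ugraph \<Rightarrow> bool" where
  "contains_properly F G \<longleftrightarrow>
     (\<exists>G'. is_subgraph G' F \<and> G' \<noteq> F \<and> graph_iso G G')"

definition st_admissible :: "'a ugraph \<Rightarrow> 'b ugraph \<Rightarrow> bool" where
  "st_admissible H G \<longleftrightarrow>
     (\<forall>F. is_subgraph F H \<and> card (uverts F) = card (uverts G) \<longrightarrow> \<not> contains_properly F G)"

text \<open>Vertices of the host graph are natural numbers, which loses no generality since
  the condition on it is invariant under isomorphism. The set of edge counts is bounded by
  \<open>n choose 2\<close> and, for a finite simple \<open>G\<close>, contains \<open>0\<close> (the edgeless graph),
  so the maximum is attained.\<close>

definition st :: "nat \<Rightarrow> 'b ugraph \<Rightarrow> nat" where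
  "st n G = Max {card (uedges H) | H :: nat ugraph.
     fin_simple_graph H \<and> card (uverts H) = n \<and> st_admissible H G}"

datatype theta_vertex = Left_End | Right_End | Inner nat nat

text \<open>The vertex at distance \<open>j\<close> from \<open>Left_End\<close> along the \<open>i\<close>-th of the \<open>s\<close> paths
  of length \<open>k\<close>; the positions \<open>0\<close> and \<open>k\<close> are shared by all paths.\<close>

definition theta_path :: "nat \<Rightarrow> nat \<Rightarrow> nat \<Rightarrow> theta_vertex" where
  "theta_path k i j = (if j = 0 then Left_End else if j = k then Right_End else Inner i j)"

definition theta_graph :: "nat \<Rightarrow> nat \<Rightarrow> theta_vertex ugraph" where
  "theta_graph s k =
     \<lparr> uverts = {theta_path k i j | i j. i < s \<and> j \<le> k},
       uedges = {{theta_path k i j, theta_path k i (Suc j)} | i j. i < s \<and> j < k} \<rparr>"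

end

theory Submission
  imports Defs "HOL-Library.FuncSet" "HOL-Computational_Algebra.Polynomial" "HOL-Algebra.Algebraic_Closure_Type"
begin

text \<open>Let \<open>k = 2 l - 1\<close> with \<open>l = 2, 3, 5\<close>, so that the exponents are \<open>1 + 1 / l\<close>.

  Upper bound. In an admissible graph the ends \<open>u, v\<close> of an edge are not joined by \<open>s\<close> internally
  disjoint paths of length \<open>k\<close>, so a set \<open>W\<close> of bounded size meets all such paths. Colour the vertices
  with three colours at random and keep the edges \<open>uv\<close> with \<open>u\<close> of colour 0, \<open>v\<close> of colour 1 and \<open>W\<close> of
  colour 2. This keeps a positive proportion of the edges and destroys all cycles of length \<open>2 l\<close>, and
  then the Bondy-Simonovits bound \<open>O(n\<^bsup>1 + 1/l\<^esup>)\<close> for graphs without such cycles applies. That bound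
  holds because the levels of a breadth first search in a graph of large minimum degree \<open>d\<close> grow
  by a factor proportional to \<open>d\<close>.

  Lower bound. Two vertices of \<open>\<theta>\<close> are joined by a path of length at most \<open>k\<close>, so a chord
  of a copy of \<open>\<theta>\<close> in a bipartite graph closes an even cycle of length at most \<open>2 l\<close>. Graphs without
  such cycles that have \<open>q\<^bsup>l + 1\<^esup>\<close> edges on \<open>2 q\<^bsup>l\<^esup>\<close> vertices are obtained for \<open>q = 3\<^bsup>i\<^esup>\<close> from the
  coordinates of generalised polygons: a point \<open>(x, p)\<close> lies on a line \<open>(y, r)\<close> iff
  \<open>p\<^sub>j + r\<^sub>j\<close> is the \<open>j\<close>-th of the monomials \<open>x y, x\<^sup>2 y, x\<^sup>3 y, x\<^sup>3 y\<^sup>2\<close> for all \<open>j < l - 1\<close>. In characteristic 3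
  cubing is additive, which makes the polynomial identity behind the absence of 10-cycles work.\<close>

section \<open>Finite fields of characteristic 3\<close>

text \<open>A prime field as a type, on which the algebraic closure is built; the fields with
  \<open>3 ^ m\<close> elements are then found inside that closure.\<close>

datatype gf3 = G0 | G1 | G2
instantiation gf3 :: field
begin
fun plus_gf3 where "plus_gf3 G0 x = x" | "plus_gf3 x G0 = x" | "plus_gf3 G1 G1 = G2" | "plus_gf3 G2 G2 = G1" | "plus_gf3 G1 G2 = G0" | "plus_gf3 G2 G1 = G0"
fun times_gf3 where "times_gf3 G0 x = G0" | "times_gf3 G1 x = x" | "times_gf3 G2 G0 = G0" | "times_gf3 G2 G1 = G2" | "times_gf3 G2 G2 = G1"
fun uminus_gf3 where "uminus_gf3 G0 = G0" | "uminus_gf3 G1 = G2" | "uminus_gf3 G2 = G1"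
definition "zero_gf3 = G0"
definition "one_gf3 = G1"
definition "minus_gf3 (x::gf3) y = x + - y"
definition "inverse_gf3 (x::gf3) = x"
definition "divide_gf3 (x::gf3) y = x * y"
instance
proof
  fix a b c :: gf3
  show "a * b * c = a * (b * c)" by (cases a; cases b; cases c) simp_all
  show "a * b = b * a" by (cases a; cases b) simp_all
  show "1 * a = a" by (simp add: one_gf3_def)
  show "a + b + c = a + (b + c)" by (cases a; cases b; cases c) simp_all
  show "a + b = b + a" by (cases a; cases b) simp_all
  show "0 + a = a" by (simp add: zero_gf3_def)
  show "- a + a = 0" by (cases a) (simp_all add: zero_gf3_def)
  show "a - b = a + - b" by (simp add: minus_gf3_def)
  show "(a + b) * c = a * c + b * c" by (cases a; cases b; cases c) simp_all
  show "(0::gf3) \<noteq> 1" by (simp add: zero_gf3_def one_gf3_def)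
  show "a \<noteq> 0 \<Longrightarrow> inverse a * a = 1" by (cases a) (simp_all add: zero_gf3_def one_gf3_def inverse_gf3_def)
  show "a div b = a * inverse b" by (simp add: divide_gf3_def inverse_gf3_def)
  show "inverse (0::gf3) = 0" by (simp add: inverse_gf3_def)
qed
end
type_synonym gf3_closure = "gf3 alg_closure"

lemma three_eq_0_gf3_closure: "(3 :: gf3_closure) = 0"
proof -
  have "(3 :: gf3) = 1 + 1 + 1" by simp
  also have "\<dots> = 0" by (simp add: one_gf3_def zero_gf3_def)
  finally have "to_ac (3 :: gf3) = to_ac 0" by simp
  then show ?thesis by simp
qed

lemma cube_diff_if_three_eq_0:
  fixes x y :: "'a::comm_ring_1"
  assumes "(3 :: 'a) = 0"
  shows "(x - y) ^ 3 = x ^ 3 - y ^ 3"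
proof -
  have "(x - y) ^ 3 = x ^ 3 - y ^ 3 + 3 * (x * y ^ 2 - x ^ 2 * y)"
    by (simp add: algebra_simps power3_eq_cube power2_eq_square)
  then show ?thesis using assms by simp
qed

lemma power_3_power_diff:
  fixes x y :: "'a::comm_ring_1"
  assumes "(3 :: 'a) = 0"
  shows "(x - y) ^ 3 ^ m = x ^ 3 ^ m - y ^ 3 ^ m"
  by (induction m) (simp_all add: mult.commute[of 3] power_mult cube_diff_if_three_eq_0[OF assms])

text \<open>For \<open>m > 0\<close> this is the field with \<open>3 ^ m\<close> elements, cut out
  of the closure as the fixed points of the \<open>m\<close>-fold Frobenius map.\<close>

definition gf3_ext :: "nat \<Rightarrow> gf3_closure set" where
  "gf3_ext m = {x. x ^ 3 ^ m = x}"

lemma gf3_ext_diff: "x \<in> gf3_ext m \<Longrightarrow> y \<in> gf3_ext m \<Longrightarrow> x - y \<in> gf3_ext m"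
  by (simp add: gf3_ext_def power_3_power_diff[OF three_eq_0_gf3_closure])

lemma gf3_ext_mult: "x \<in> gf3_ext m \<Longrightarrow> y \<in> gf3_ext m \<Longrightarrow> x * y \<in> gf3_ext m"
  by (simp add: gf3_ext_def power_mult_distrib)

text \<open>With \<open>q = 3 ^ m\<close>, the polynomial \<open>X^q - X\<close> splits over the
  algebraic closure. Since \<open>q\<close> vanishes in characteristic 3, its derivative is -1, so
  no root is repeated and there are as many roots as the degree says.\<close>

lemma card_gf3_ext:
  assumes "m > 0"
  shows "finite (gf3_ext m)" "card (gf3_ext m) = 3 ^ m"
proof -
  define q :: nat where "q = 3 ^ m"
  have q: "q \<ge> 2" using power_increasing[of 1 m "3::nat"] assms unfolding q_def by simp
  have q0: "of_nat q = (0 :: gf3_closure)" using assms three_eq_0_gf3_closure by (simp add: q_def)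
  define p :: "gf3_closure poly" where "p = monom 1 q - [:0, 1:]"
  have ev: "poly p x = x ^ q - x" for x by (simp add: p_def poly_monom)
  have deg: "degree p = q"
    unfolding p_def diff_conv_add_uminus using q
    by (subst degree_add_eq_left) (simp_all add: degree_monom_eq)
  have "p \<noteq> 0" using deg q by auto
  then obtain A where A: "size A = degree p" "p = smult (lead_coeff p) (\<Prod>x\<in>#A. [:- x, 1:])"
    using alg_closed_imp_factorization by blast
  have d: "pderiv p = [:-1:]" using q0 by (simp add: p_def pderiv_diff pderiv_monom pderiv_pCons one_pCons)
  have "count A x \<le> 1" for x
  proof (rule ccontr)
    assume "\<not> count A x \<le> 1"
    then have "replicate_mset 2 x \<subseteq># A" by (simp flip: count_le_replicate_mset_subset_eq)
    then obtain B where "A = add_mset x (add_mset x B)"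
      by (auto simp: numeral_2_eq_2 mset_subset_eq_exists_conv)
    then have "p = [:- x, 1:] * ([:- x, 1:] * smult (lead_coeff p) (\<Prod>x\<in>#B. [:- x, 1:]))"
      using A(2) by (simp only: image_mset_add_mset mult_smult_right prod_mset.add_mset)
    then obtain r where r: "p = [:- x, 1:] * ([:- x, 1:] * r)" by blast
    have "poly (pderiv p) x = 0" unfolding r pderiv_mult poly_add poly_mult by simp
    then show False using d by simp
  qed
  then have cnt: "count A x = (if x \<in># A then 1 else 0)" for x
    using le_antisym[of "count A x" 1 for x] by (auto simp: not_in_iff simp flip: count_greater_zero_iff)
  have lc: "lead_coeff p \<noteq> 0" using \<open>p \<noteq> 0\<close> by simp
  have "x \<in> gf3_ext m \<longleftrightarrow> x \<in># A" for x
  proof -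
    have "x \<in> gf3_ext m \<longleftrightarrow> poly p x = 0" by (simp add: gf3_ext_def ev q_def)
    also have "\<dots> \<longleftrightarrow> poly (\<Prod>x\<in>#A. [:- x, 1:]) x = 0"
      by (subst A(2)) (use lc in simp)
    also have "\<dots> \<longleftrightarrow> x \<in># A" by (induction A) auto
    finally show ?thesis .
  qed
  then have ex: "gf3_ext m = set_mset A" by blast
  have "size A = card (set_mset A)" by (simp add: size_multiset_overloaded_eq cnt)
  then show "finite (gf3_ext m)" "card (gf3_ext m) = 3 ^ m"
    using ex A(1) deg by (simp_all add: q_def)
qed

section \<open>Closed sequences in characteristic 3\<close>

text \<open>The equations of this section come from a cycle of \<open>t\<close> points and
  \<open>t\<close> lines with first coordinates \<open>a\<^sub>i\<close> and
  \<open>b\<^sub>i\<close>, where line \<open>i\<close> meets the points \<open>i\<close> and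
  \<open>i + 1\<close>: eliminating the other coordinates leaves one equation per monomial. For
  \<open>t = 2\<close> the left side is a product of two differences.\<close>

lemma no_closed_pair:
  fixes a\<^sub>1 a\<^sub>2 b\<^sub>1 b\<^sub>2 :: "'a::idom"
  assumes "b\<^sub>1 * (a\<^sub>1 - a\<^sub>2) + b\<^sub>2 * (a\<^sub>2 - a\<^sub>1) = 0"
  shows "a\<^sub>1 = a\<^sub>2 \<or> b\<^sub>1 = b\<^sub>2"
  using assms by Groebner_Basis.algebra

text \<open>By Abel summation the weights \<open>b\<^sub>i - b\<^sub>i\<^sub>-\<^sub>1\<close> at
  the points \<open>a\<^sub>i\<close> annihilate \<open>1\<close>, \<open>X\<close> and
  \<open>X^2\<close>. Applied to \<open>(X - a\<^sub>2) * (X - a\<^sub>3)\<close>, only the term at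
  \<open>a\<^sub>1\<close> survives.\<close>

lemma no_closed_triple:
  fixes a\<^sub>1 a\<^sub>2 a\<^sub>3 b\<^sub>1 b\<^sub>2 b\<^sub>3 :: "'a::idom"
  assumes "b\<^sub>1 * (a\<^sub>1 - a\<^sub>2) + b\<^sub>2 * (a\<^sub>2 - a\<^sub>3) + b\<^sub>3 * (a\<^sub>3 - a\<^sub>1) = 0"
    and "b\<^sub>1 * (a\<^sub>1^2 - a\<^sub>2^2) + b\<^sub>2 * (a\<^sub>2^2 - a\<^sub>3^2) + b\<^sub>3 * (a\<^sub>3^2 - a\<^sub>1^2) = 0"
  shows "b\<^sub>1 = b\<^sub>3 \<or> a\<^sub>1 = a\<^sub>2 \<or> a\<^sub>3 = a\<^sub>1"
proof -
  have "(b\<^sub>1 - b\<^sub>3) * ((a\<^sub>1 - a\<^sub>2) * (a\<^sub>3 - a\<^sub>1)) = 0" using assms by Groebner_Basis.algebra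
  then show ?thesis by auto
qed

text \<open>The same argument with the cubic that vanishes at \<open>a\<^sub>2\<close>,
  \<open>a\<^sub>3\<close> and \<open>a\<^sub>4\<close>; the factor
  \<open>a\<^sub>1 - a\<^sub>3\<close> is the only one that can be 0.\<close>

lemma closed_quadruple_opposite_eq:
  fixes a\<^sub>1 a\<^sub>2 a\<^sub>3 a\<^sub>4 b\<^sub>1 b\<^sub>2 b\<^sub>3 b\<^sub>4 :: "'a::idom"
  assumes "b\<^sub>1 * (a\<^sub>1 - a\<^sub>2) + b\<^sub>2 * (a\<^sub>2 - a\<^sub>3) + b\<^sub>3 * (a\<^sub>3 - a\<^sub>4) + b\<^sub>4 * (a\<^sub>4 - a\<^sub>1) = 0"
    and "b\<^sub>1 * (a\<^sub>1^2 - a\<^sub>2^2) + b\<^sub>2 * (a\<^sub>2^2 - a\<^sub>3^2) + b\<^sub>3 * (a\<^sub>3^2 - a\<^sub>4^2) + b\<^sub>4 * (a\<^sub>4^2 - a\<^sub>1^2) = 0"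
    and "b\<^sub>1 * (a\<^sub>1^3 - a\<^sub>2^3) + b\<^sub>2 * (a\<^sub>2^3 - a\<^sub>3^3) + b\<^sub>3 * (a\<^sub>3^3 - a\<^sub>4^3) + b\<^sub>4 * (a\<^sub>4^3 - a\<^sub>1^3) = 0"
    and "b\<^sub>1 \<noteq> b\<^sub>4" "a\<^sub>1 \<noteq> a\<^sub>2" "a\<^sub>4 \<noteq> a\<^sub>1"
  shows "a\<^sub>1 = a\<^sub>3"
proof -
  have "(b\<^sub>1 - b\<^sub>4) * ((a\<^sub>1 - a\<^sub>2) * (a\<^sub>1 - a\<^sub>3) * (a\<^sub>4 - a\<^sub>1)) = 0" using assms(1-3) by Groebner_Basis.algebra
  then show ?thesis using assms(4-6) by simp
qed

text \<open>Opposite \<open>a\<^sub>i\<close> coincide, so the first and the last equation reduce to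
  alternating sums of the \<open>b\<^sub>i\<close> and of their squares; for the squares, additivity
  of cubing turns the difference of cubes into the cube of a nonzero difference. Together the two
  sums force two consecutive \<open>b\<^sub>i\<close> to be equal.\<close>

lemma no_closed_quadruple:
  fixes a\<^sub>1 a\<^sub>2 a\<^sub>3 a\<^sub>4 b\<^sub>1 b\<^sub>2 b\<^sub>3 b\<^sub>4 :: "'a::idom"
  assumes char: "(3 :: 'a) = 0"
    and e: "b\<^sub>1 * (a\<^sub>1 - a\<^sub>2) + b\<^sub>2 * (a\<^sub>2 - a\<^sub>3) + b\<^sub>3 * (a\<^sub>3 - a\<^sub>4) + b\<^sub>4 * (a\<^sub>4 - a\<^sub>1) = 0"
      "b\<^sub>1 * (a\<^sub>1^2 - a\<^sub>2^2) + b\<^sub>2 * (a\<^sub>2^2 - a\<^sub>3^2) + b\<^sub>3 * (a\<^sub>3^2 - a\<^sub>4^2) + b\<^sub>4 * (a\<^sub>4^2 - a\<^sub>1^2) = 0"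
      "b\<^sub>1 * (a\<^sub>1^3 - a\<^sub>2^3) + b\<^sub>2 * (a\<^sub>2^3 - a\<^sub>3^3) + b\<^sub>3 * (a\<^sub>3^3 - a\<^sub>4^3) + b\<^sub>4 * (a\<^sub>4^3 - a\<^sub>1^3) = 0"
      "b\<^sub>1^2 * (a\<^sub>1^3 - a\<^sub>2^3) + b\<^sub>2^2 * (a\<^sub>2^3 - a\<^sub>3^3) + b\<^sub>3^2 * (a\<^sub>3^3 - a\<^sub>4^3) + b\<^sub>4^2 * (a\<^sub>4^3 - a\<^sub>1^3) = 0"
    and a: "a\<^sub>1 \<noteq> a\<^sub>2" "a\<^sub>2 \<noteq> a\<^sub>3" "a\<^sub>3 \<noteq> a\<^sub>4" "a\<^sub>4 \<noteq> a\<^sub>1"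
    and b: "b\<^sub>1 \<noteq> b\<^sub>2" "b\<^sub>2 \<noteq> b\<^sub>3" "b\<^sub>3 \<noteq> b\<^sub>4" "b\<^sub>4 \<noteq> b\<^sub>1"
  shows False
proof -
  have 13: "a\<^sub>1 = a\<^sub>3" using closed_quadruple_opposite_eq[OF e(1-3)] a b by blast
  have 24: "a\<^sub>2 = a\<^sub>4"
    by (rule closed_quadruple_opposite_eq[of b\<^sub>2 a\<^sub>2 a\<^sub>3 b\<^sub>3 a\<^sub>4 b\<^sub>4 a\<^sub>1 b\<^sub>1])
      (use e(1-3) a b in \<open>auto simp: ac_simps\<close>)
  have "(b\<^sub>1 - b\<^sub>2 + b\<^sub>3 - b\<^sub>4) * (a\<^sub>1 - a\<^sub>2) = 0" using e(1) 13 24 by Groebner_Basis.algebra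
  then have s: "b\<^sub>1 - b\<^sub>2 + b\<^sub>3 - b\<^sub>4 = 0" using a by simp
  have "(b\<^sub>1^2 - b\<^sub>2^2 + b\<^sub>3^2 - b\<^sub>4^2) * (a\<^sub>1 - a\<^sub>2)^3 = 0"
    unfolding cube_diff_if_three_eq_0[OF char] using e(4) 13 24 by Groebner_Basis.algebra
  then have "b\<^sub>1^2 - b\<^sub>2^2 + b\<^sub>3^2 - b\<^sub>4^2 = 0" using a by simp
  with s have "2 * ((b\<^sub>1 - b\<^sub>2) * (b\<^sub>4 - b\<^sub>1)) = 0" by Groebner_Basis.algebra
  moreover have "(2 :: 'a) \<noteq> 0"
  proof
    assume "(2 :: 'a) = 0"
    have "(3 :: 'a) = 2 + 1" by simp
    then show False using char \<open>(2 :: 'a) = 0\<close> by simp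
  qed
  ultimately show False using b by simp
qed

text \<open>If \<open>a\<^sub>1 = a\<^sub>3\<close>, a cubic vanishing at \<open>a\<^sub>1\<close>,
  \<open>a\<^sub>2\<close>, \<open>a\<^sub>4\<close> isolates the weight at \<open>a\<^sub>5\<close>
  and forces \<open>a\<^sub>5 = a\<^sub>2\<close>. Then only three different points remain, and a
  quadratic isolates the nonzero weight at \<open>a\<^sub>4\<close>.\<close>

lemma closed_quintuple_distinct:
  fixes a\<^sub>1 a\<^sub>2 a\<^sub>3 a\<^sub>4 a\<^sub>5 b\<^sub>1 b\<^sub>2 b\<^sub>3 b\<^sub>4 b\<^sub>5 :: "'a::idom"
  assumes e: "b\<^sub>1 * (a\<^sub>1 - a\<^sub>2) + b\<^sub>2 * (a\<^sub>2 - a\<^sub>3) + b\<^sub>3 * (a\<^sub>3 - a\<^sub>4) + b\<^sub>4 * (a\<^sub>4 - a\<^sub>5) + b\<^sub>5 * (a\<^sub>5 - a\<^sub>1) = 0"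
    "b\<^sub>1 * (a\<^sub>1^2 - a\<^sub>2^2) + b\<^sub>2 * (a\<^sub>2^2 - a\<^sub>3^2) + b\<^sub>3 * (a\<^sub>3^2 - a\<^sub>4^2) + b\<^sub>4 * (a\<^sub>4^2 - a\<^sub>5^2) + b\<^sub>5 * (a\<^sub>5^2 - a\<^sub>1^2) = 0"
    "b\<^sub>1 * (a\<^sub>1^3 - a\<^sub>2^3) + b\<^sub>2 * (a\<^sub>2^3 - a\<^sub>3^3) + b\<^sub>3 * (a\<^sub>3^3 - a\<^sub>4^3) + b\<^sub>4 * (a\<^sub>4^3 - a\<^sub>5^3) + b\<^sub>5 * (a\<^sub>5^3 - a\<^sub>1^3) = 0"
    and a: "a\<^sub>1 \<noteq> a\<^sub>2" "a\<^sub>2 \<noteq> a\<^sub>3" "a\<^sub>3 \<noteq> a\<^sub>4" "a\<^sub>4 \<noteq> a\<^sub>5" "a\<^sub>5 \<noteq> a\<^sub>1"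
    and b: "b\<^sub>1 \<noteq> b\<^sub>2" "b\<^sub>2 \<noteq> b\<^sub>3" "b\<^sub>3 \<noteq> b\<^sub>4" "b\<^sub>4 \<noteq> b\<^sub>5" "b\<^sub>5 \<noteq> b\<^sub>1"
  shows "a\<^sub>1 \<noteq> a\<^sub>3"
proof
  assume 13: "a\<^sub>1 = a\<^sub>3"
  have "(b\<^sub>5 - b\<^sub>4) * ((a\<^sub>5 - a\<^sub>1) * (a\<^sub>5 - a\<^sub>2) * (a\<^sub>5 - a\<^sub>4)) = 0" using e 13 by Groebner_Basis.algebra
  then have 52: "a\<^sub>5 = a\<^sub>2" using a b by simp
  have "(b\<^sub>4 - b\<^sub>3) * ((a\<^sub>4 - a\<^sub>3) * (a\<^sub>4 - a\<^sub>5)) = 0" using e(1,2) 13 52 by Groebner_Basis.algebra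
  then show False using a b by simp
qed

text \<open>The form vanishes for \<open>x = y\<close>, \<open>f = g\<close>. If
  \<open>x - y\<close> divides \<open>g - f\<close>, then \<open>(x - y)^2\<close> splits off up to
  a multiple of 3. The form is what two of the Lagrange weights contribute to the last equation for
  quintuples.\<close>

lemma quintuple_form_factor:
  fixes x y f g s :: "'a::comm_ring_1"
  assumes char: "(3 :: 'a) = 0" and g: "g = f + (x - y) * s"
  shows "f\<^sup>2 * x\<^sup>2 - 2 * f * g * y\<^sup>2 + g\<^sup>2 * x * y = (x - y)\<^sup>2 * (f\<^sup>2 - f * s * y + s\<^sup>2 * x * y)"
proof -
  have "f\<^sup>2 * x\<^sup>2 - 2 * f * g * y\<^sup>2 + g\<^sup>2 * x * y =
    (x - y)\<^sup>2 * (f\<^sup>2 - f * s * y + s\<^sup>2 * x * y) + 3 * (f * g * y * (x - y))"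
    unfolding g by (simp add: algebra_simps power2_eq_square)
  then show ?thesis using char by simp
qed

text \<open>By Abel summation the first three equations say that the differences of consecutive
  \<open>b\<^sub>i\<close> annihilate all polynomials of degree at most 3 in the \<open>a\<^sub>i\<close>. Since the \<open>a\<^sub>i\<close> are distinct,
  these differences are the Lagrange weights up to a factor. Substituting this into the last
  equation, with \<open>a\<^sub>3\<close> and \<open>b\<^sub>5\<close> shifted to 0, leaves a product of differences of the \<open>a\<^sub>i\<close>.\<close>

lemma no_closed_quintuple:
  fixes a\<^sub>1 a\<^sub>2 a\<^sub>3 a\<^sub>4 a\<^sub>5 b\<^sub>1 b\<^sub>2 b\<^sub>3 b\<^sub>4 b\<^sub>5 :: "'a::field"
  assumes char: "(3 :: 'a) = 0"
    and e: "b\<^sub>1 * (a\<^sub>1 - a\<^sub>2) + b\<^sub>2 * (a\<^sub>2 - a\<^sub>3) + b\<^sub>3 * (a\<^sub>3 - a\<^sub>4) + b\<^sub>4 * (a\<^sub>4 - a\<^sub>5) + b\<^sub>5 * (a\<^sub>5 - a\<^sub>1) = 0"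
      "b\<^sub>1 * (a\<^sub>1^2 - a\<^sub>2^2) + b\<^sub>2 * (a\<^sub>2^2 - a\<^sub>3^2) + b\<^sub>3 * (a\<^sub>3^2 - a\<^sub>4^2) + b\<^sub>4 * (a\<^sub>4^2 - a\<^sub>5^2) + b\<^sub>5 * (a\<^sub>5^2 - a\<^sub>1^2) = 0"
      "b\<^sub>1 * (a\<^sub>1^3 - a\<^sub>2^3) + b\<^sub>2 * (a\<^sub>2^3 - a\<^sub>3^3) + b\<^sub>3 * (a\<^sub>3^3 - a\<^sub>4^3) + b\<^sub>4 * (a\<^sub>4^3 - a\<^sub>5^3) + b\<^sub>5 * (a\<^sub>5^3 - a\<^sub>1^3) = 0"
      "b\<^sub>1^2 * (a\<^sub>1^3 - a\<^sub>2^3) + b\<^sub>2^2 * (a\<^sub>2^3 - a\<^sub>3^3) + b\<^sub>3^2 * (a\<^sub>3^3 - a\<^sub>4^3) + b\<^sub>4^2 * (a\<^sub>4^3 - a\<^sub>5^3) + b\<^sub>5^2 * (a\<^sub>5^3 - a\<^sub>1^3) = 0"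
    and a: "a\<^sub>1 \<noteq> a\<^sub>2" "a\<^sub>2 \<noteq> a\<^sub>3" "a\<^sub>3 \<noteq> a\<^sub>4" "a\<^sub>4 \<noteq> a\<^sub>5" "a\<^sub>5 \<noteq> a\<^sub>1"
    and b: "b\<^sub>1 \<noteq> b\<^sub>2" "b\<^sub>2 \<noteq> b\<^sub>3" "b\<^sub>3 \<noteq> b\<^sub>4" "b\<^sub>4 \<noteq> b\<^sub>5" "b\<^sub>5 \<noteq> b\<^sub>1"
  shows False
proof -
  have 13: "a\<^sub>1 \<noteq> a\<^sub>3"
    by (rule closed_quintuple_distinct[OF e(1-3) a b])
  \<comment> \<open>The remaining diagonals follow by rotating the indices.\<close>
  have 24: "a\<^sub>2 \<noteq> a\<^sub>4"
    by (rule closed_quintuple_distinct[of b\<^sub>2 a\<^sub>2 a\<^sub>3 b\<^sub>3 a\<^sub>4 b\<^sub>4 a\<^sub>5 b\<^sub>5 a\<^sub>1 b\<^sub>1])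
      (use e(1-3) a b in \<open>auto simp: ac_simps\<close>)
  have 35: "a\<^sub>3 \<noteq> a\<^sub>5"
    by (rule closed_quintuple_distinct[of b\<^sub>3 a\<^sub>3 a\<^sub>4 b\<^sub>4 a\<^sub>5 b\<^sub>5 a\<^sub>1 b\<^sub>1 a\<^sub>2 b\<^sub>2])
      (use e(1-3) a b in \<open>auto simp: ac_simps\<close>)
  have 41: "a\<^sub>4 \<noteq> a\<^sub>1"
    by (rule closed_quintuple_distinct[of b\<^sub>4 a\<^sub>4 a\<^sub>5 b\<^sub>5 a\<^sub>1 b\<^sub>1 a\<^sub>2 b\<^sub>2 a\<^sub>3 b\<^sub>3])
      (use e(1-3) a b in \<open>auto simp: ac_simps\<close>)
  have 52: "a\<^sub>5 \<noteq> a\<^sub>2"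
    by (rule closed_quintuple_distinct[of b\<^sub>5 a\<^sub>5 a\<^sub>1 b\<^sub>1 a\<^sub>2 b\<^sub>2 a\<^sub>3 b\<^sub>3 a\<^sub>4 b\<^sub>4])
      (use e(1-3) a b in \<open>auto simp: ac_simps\<close>)
  define x y z w where "x = a\<^sub>1 - a\<^sub>3" and "y = a\<^sub>2 - a\<^sub>3" and "z = a\<^sub>4 - a\<^sub>3" and "w = a\<^sub>5 - a\<^sub>3"
  note xyzw = this
  define c\<^sub>1 c\<^sub>2 c\<^sub>4 c\<^sub>5 where "c\<^sub>1 = b\<^sub>1 - b\<^sub>5" and "c\<^sub>2 = b\<^sub>2 - b\<^sub>1" and "c\<^sub>4 = b\<^sub>4 - b\<^sub>3" and "c\<^sub>5 = b\<^sub>5 - b\<^sub>4"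
  note c = this
  have ne: "x \<noteq> 0" "x - y \<noteq> 0" "x - z \<noteq> 0" "x - w \<noteq> 0" "y - z \<noteq> 0" "y - w \<noteq> 0" "z - w \<noteq> 0" "c\<^sub>1 \<noteq> 0"
    using a b 13 24 35 41 52 by (auto simp: xyzw c)
  have m1: "c\<^sub>1 * x + c\<^sub>2 * y + c\<^sub>4 * z + c\<^sub>5 * w = 0"
    unfolding xyzw c using e(1) by Groebner_Basis.algebra
  have m2: "c\<^sub>1 * x^2 + c\<^sub>2 * y^2 + c\<^sub>4 * z^2 + c\<^sub>5 * w^2 = 0"
    unfolding xyzw c using e(1,2) by Groebner_Basis.algebra
  have m3: "c\<^sub>1 * x^3 + c\<^sub>2 * y^3 + c\<^sub>4 * z^3 + c\<^sub>5 * w^3 = 0"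
    unfolding xyzw c using e(1-3) by Groebner_Basis.algebra
  \<comment> \<open>With \<open>b\<^sub>5\<close> as origin, \<open>b\<^sub>1\<close> and
    \<open>b\<^sub>2\<close> become \<open>c\<^sub>1\<close> and
    \<open>c\<^sub>1 + c\<^sub>2\<close>, while \<open>b\<^sub>4\<close> and
    \<open>b\<^sub>3\<close> become \<open>- c\<^sub>5\<close> and
    \<open>- (c\<^sub>5 + c\<^sub>4)\<close>. The last equation thus splits into a part at
    \<open>x\<close>, \<open>y\<close> and its mirror image at \<open>w\<close>,
    \<open>z\<close>.\<close>
  have Q: "c\<^sub>1^2 * x^3 + 2 * c\<^sub>1 * c\<^sub>2 * y^3 + c\<^sub>2^2 * y^3 - (c\<^sub>5^2 * w^3 + 2 * c\<^sub>5 * c\<^sub>4 * z^3 + c\<^sub>4^2 * z^3) = 0"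
    unfolding xyzw c cube_diff_if_three_eq_0[OF char] using e(3,4) by Groebner_Basis.algebra
  \<comment> \<open>By \<open>m1\<close>, \<open>m2\<close>, \<open>m3\<close> the products of
    weights and points annihilate all quadratics at four distinct points, so they are determined up
    to a factor \<open>k\<close>: each is \<open>k\<close> times a signed Vandermonde determinant of
    the other three points.\<close>
  define k where "k = c\<^sub>1 * x / ((y - z) * (y - w) * (z - w))"
  have d1: "c\<^sub>1 * x = k * (y - z) * (y - w) * (z - w)"
    using ne by (simp add: k_def)
  then have "k \<noteq> 0" using ne by auto
  have "c\<^sub>2 * y * ((y - z) * (y - w)) = - k * (x - z) * (x - w) * (z - w) * ((y - z) * (y - w))"
    using m1 m2 m3 d1 by Groebner_Basis.algebra
  from mult_right_cancel[THEN iffD1, OF _ this] have d2: "c\<^sub>2 * y = - k * (x - z) * (x - w) * (z - w)" using ne by simp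
  have "c\<^sub>4 * z * ((y - z) * (z - w)) = k * (x - y) * (x - w) * (y - w) * ((y - z) * (z - w))"
    using m1 m2 m3 d1 by Groebner_Basis.algebra
  from mult_right_cancel[THEN iffD1, OF _ this] have d4: "c\<^sub>4 * z = k * (x - y) * (x - w) * (y - w)" using ne by simp
  have "c\<^sub>5 * w * ((y - w) * (z - w)) = - k * (x - y) * (x - z) * (y - z) * ((y - w) * (z - w))"
    using m1 m2 m3 d1 by Groebner_Basis.algebra
  from mult_right_cancel[THEN iffD1, OF _ this] have d5: "c\<^sub>5 * w = - k * (x - y) * (x - z) * (y - z)" using ne by simp
  define f g s f' g' s' where "f = (y - z) * (y - w)" and "g = (x - z) * (x - w)" and "s = x + y - z - w"
    and "f' = (z - y) * (z - x)" and "g' = (w - y) * (w - x)" and "s' = w + z - y - x"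
  note fgs = this
  \<comment> \<open>Multiplying \<open>Q\<close> by \<open>x * w\<close> makes the weights occur
    only in the known products such as \<open>c\<^sub>1 * x\<close>.\<close>
  have "0 = w * ((c\<^sub>1 * x)^2 * x^2 + 2 * (c\<^sub>1 * x) * (c\<^sub>2 * y) * y^2 + (c\<^sub>2 * y)^2 * x * y)
     - x * ((c\<^sub>5 * w)^2 * w^2 + 2 * (c\<^sub>5 * w) * (c\<^sub>4 * z) * z^2 + (c\<^sub>4 * z)^2 * w * z)"
    using Q by Groebner_Basis.algebra
  also have "\<dots> = k^2 * (w * (z - w)^2 * (f^2 * x^2 - 2 * f * g * y^2 + g^2 * x * y)
      - x * (x - y)^2 * (f'^2 * w^2 - 2 * f' * g' * z^2 + g'^2 * w * z))"
    unfolding d1 d2 d4 d5 fgs by Groebner_Basis.algebra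
  also have "f^2 * x^2 - 2 * f * g * y^2 + g^2 * x * y = (x - y)^2 * (f^2 - f * s * y + s^2 * x * y)"
    by (rule quintuple_form_factor[OF char]) (simp add: fgs algebra_simps)
  also have "f'^2 * w^2 - 2 * f' * g' * z^2 + g'^2 * w * z = (w - z)^2 * (f'^2 - f' * s' * z + s'^2 * w * z)"
    by (rule quintuple_form_factor[OF char]) (simp add: fgs algebra_simps)
  also have "k^2 * (w * (z - w)^2 * ((x - y)^2 * (f^2 - f * s * y + s^2 * x * y))
      - x * (x - y)^2 * ((w - z)^2 * (f'^2 - f' * s' * z + s'^2 * w * z)))
    = k^2 * (x - y)^2 * (z - w)^2 * (w * (f^2 - f * s * y + s^2 * x * y) - x * (f'^2 - f' * s' * z + s'^2 * w * z))"
    by Groebner_Basis.algebra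
  \<comment> \<open>The two mirrored parts combine to a product of differences, all of which are
    nonzero.\<close>
  also have "w * (f^2 - f * s * y + s^2 * x * y) - x * (f'^2 - f' * s' * z + s'^2 * w * z)
     = - ((x - z) * (x - w)^2 * (y - z) * (y - w))"
    unfolding fgs by Groebner_Basis.algebra
  finally show False using ne \<open>k \<noteq> 0\<close> by simp
qed

section \<open>Even cycles in dense bipartite graphs\<close>

text \<open>Delete vertices of degree at most \<open>M\<close> one at a time. Each deletion costs at
  most \<open>M\<close> edges and lowers the bound \<open>M * (card A + card Y)\<close> by
  \<open>M\<close>, so the excess of edges persists and the process stops before they run
  out.\<close>

lemma bipartite_min_degree_subgraph:
  fixes B :: "('a \<times> 'b) set"
  assumes "finite A" "finite Y" "B \<subseteq> A \<times> Y" "card B > M * (card A + card Y)"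
  obtains A' Y' where "A' \<subseteq> A" "Y' \<subseteq> Y" "B \<inter> A' \<times> Y' \<noteq> {}"
    "\<And>a. a \<in> A' \<Longrightarrow> card {y\<in>Y'. (a, y) \<in> B} > M" "\<And>y. y \<in> Y' \<Longrightarrow> card {a\<in>A'. (a, y) \<in> B} > M"
proof -
  have "\<exists>A' Y'. A' \<subseteq> A \<and> Y' \<subseteq> Y \<and> B \<inter> A' \<times> Y' \<noteq> {} \<and>
    (\<forall>a\<in>A'. card {y\<in>Y'. (a, y) \<in> B} > M) \<and> (\<forall>y\<in>Y'. card {a\<in>A'. (a, y) \<in> B} > M)"
    using assms
  proof (induction "card A + card Y" arbitrary: A Y B rule: less_induct)
    case less
    have finB: "finite B" using less.prems by (meson finite_SigmaI finite_subset)
    show ?case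
    proof (cases "(\<forall>a\<in>A. card {y\<in>Y. (a, y) \<in> B} > M) \<and> (\<forall>y\<in>Y. card {a\<in>A. (a, y) \<in> B} > M)")
      case True
      have "B \<noteq> {}" using less.prems(4) by auto
      then have "B \<inter> A \<times> Y \<noteq> {}" using less.prems(3) by blast
      with True show ?thesis by blast
    next
      case False
      then consider (a) a where "a \<in> A" "card {y\<in>Y. (a, y) \<in> B} \<le> M"
        | (y) y where "y \<in> Y" "card {a\<in>A. (a, y) \<in> B} \<le> M"
        by (meson not_le)
      then show ?thesis
      proof cases
        case a
        let ?A = "A - {a}" and ?B = "B \<inter> (A - {a}) \<times> Y"
        have cA: "card A = Suc (card ?A)" using less.prems(1) a(1) by (rule card.remove)
        have "B \<subseteq> ?B \<union> Pair a ` {y\<in>Y. (a, y) \<in> B}" using less.prems(3) by auto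
        then have "card B \<le> card (?B \<union> Pair a ` {y\<in>Y. (a, y) \<in> B})"
          using finB less.prems(2) by (intro card_mono) auto
        also have "\<dots> \<le> card ?B + card (Pair a ` {y\<in>Y. (a, y) \<in> B})" by (rule card_Un_le)
        also have "card (Pair a ` {y\<in>Y. (a, y) \<in> B}) \<le> M"
          using a(2) by (simp add: card_image inj_on_def)
        finally have "card ?B > M * (card ?A + card Y)" using less.prems(4) cA by simp
        then have "\<exists>A' Y'. A' \<subseteq> ?A \<and> Y' \<subseteq> Y \<and> ?B \<inter> A' \<times> Y' \<noteq> {} \<and>
          (\<forall>a\<in>A'. card {y\<in>Y'. (a, y) \<in> ?B} > M) \<and> (\<forall>y\<in>Y'. card {a\<in>A'. (a, y) \<in> ?B} > M)"
          by (intro less.hyps) (use cA less.prems(1,2) in simp_all)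
        then obtain A' Y' where "A' \<subseteq> ?A" "Y' \<subseteq> Y" "?B \<inter> A' \<times> Y' \<noteq> {}"
          "\<forall>a\<in>A'. card {y\<in>Y'. (a, y) \<in> ?B} > M" "\<forall>y\<in>Y'. card {a\<in>A'. (a, y) \<in> ?B} > M"
          by (elim exE conjE)
        moreover have "x \<in> A' \<Longrightarrow> {y\<in>Y'. (x, y) \<in> ?B} = {y\<in>Y'. (x, y) \<in> B}" for x
          using \<open>A' \<subseteq> ?A\<close> \<open>Y' \<subseteq> Y\<close> by auto
        moreover have "y \<in> Y' \<Longrightarrow> {a\<in>A'. (a, y) \<in> ?B} = {a\<in>A'. (a, y) \<in> B}" for y
          using \<open>A' \<subseteq> ?A\<close> \<open>Y' \<subseteq> Y\<close> by auto
        ultimately show ?thesis by (intro exI[of _ A'] exI[of _ Y']) auto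
      next
        case y
        let ?Y = "Y - {y}" and ?B = "B \<inter> A \<times> (Y - {y})"
        have cY: "card Y = Suc (card ?Y)" using less.prems(2) y(1) by (rule card.remove)
        have "B \<subseteq> ?B \<union> (\<lambda>a. (a, y)) ` {a\<in>A. (a, y) \<in> B}" using less.prems(3) by auto
        then have "card B \<le> card (?B \<union> (\<lambda>a. (a, y)) ` {a\<in>A. (a, y) \<in> B})"
          using finB less.prems(1) by (intro card_mono) auto
        also have "\<dots> \<le> card ?B + card ((\<lambda>a. (a, y)) ` {a\<in>A. (a, y) \<in> B})" by (rule card_Un_le)
        also have "card ((\<lambda>a. (a, y)) ` {a\<in>A. (a, y) \<in> B}) \<le> M"
          using y(2) by (simp add: card_image inj_on_def)
        finally have "card ?B > M * (card A + card ?Y)" using less.prems(4) cY by simp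
        then have "\<exists>A' Y'. A' \<subseteq> A \<and> Y' \<subseteq> ?Y \<and> ?B \<inter> A' \<times> Y' \<noteq> {} \<and>
          (\<forall>a\<in>A'. card {y\<in>Y'. (a, y) \<in> ?B} > M) \<and> (\<forall>y\<in>Y'. card {a\<in>A'. (a, y) \<in> ?B} > M)"
          by (intro less.hyps) (use cY less.prems(1,2) in simp_all)
        then obtain A' Y' where "A' \<subseteq> A" "Y' \<subseteq> ?Y" "?B \<inter> A' \<times> Y' \<noteq> {}"
          "\<forall>a\<in>A'. card {y\<in>Y'. (a, y) \<in> ?B} > M" "\<forall>y\<in>Y'. card {a\<in>A'. (a, y) \<in> ?B} > M"
          by (elim exE conjE)
        moreover have "x \<in> A' \<Longrightarrow> {y\<in>Y'. (x, y) \<in> ?B} = {y\<in>Y'. (x, y) \<in> B}" for x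
          using \<open>A' \<subseteq> A\<close> \<open>Y' \<subseteq> ?Y\<close> by auto
        moreover have "y' \<in> Y' \<Longrightarrow> {a\<in>A'. (a, y') \<in> ?B} = {a\<in>A'. (a, y') \<in> B}" for y'
          using \<open>A' \<subseteq> A\<close> \<open>Y' \<subseteq> ?Y\<close> by auto
        ultimately show ?thesis by (intro exI[of _ A'] exI[of _ Y']) auto
      qed
    qed
  qed
  then show ?thesis using that by blast
qed

text \<open>Greedy extension: before each step the path has at most \<open>M\<close> vertices while
  its end has more than \<open>M\<close> neighbours, so one of them is new.\<close>

lemma bipartite_path_from:
  fixes B :: "('a \<times> 'a) set"
  assumes "finite A" "finite Y" "A \<inter> Y = {}" "a\<^sub>0 \<in> A"
    and "\<And>a. a \<in> A \<Longrightarrow> card {y\<in>Y. (a, y) \<in> B} > M" "\<And>y. y \<in> Y \<Longrightarrow> card {a\<in>A. (a, y) \<in> B} > M"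
    and "i \<le> M"
  shows "\<exists>p :: nat \<Rightarrow> 'a. p 0 = a\<^sub>0 \<and> inj_on p {..i} \<and> (\<forall>j\<le>i. p j \<in> (if even j then A else Y)) \<and>
    (\<forall>j<i. (p j, p (Suc j)) \<in> B \<or> (p (Suc j), p j) \<in> B)"
  using \<open>i \<le> M\<close>
proof (induction i)
  case 0
  show ?case using assms(4) by (intro exI[of _ "\<lambda>_. a\<^sub>0"]) auto
next
  case (Suc i)
  then obtain p where p: "p 0 = a\<^sub>0" "inj_on p {..i}" "\<forall>j\<le>i. p j \<in> (if even j then A else Y)"
    "\<forall>j<i. (p j, p (Suc j)) \<in> B \<or> (p (Suc j), p j) \<in> B" by auto
  define N where "N = (if even i then {y\<in>Y. (p i, y) \<in> B} else {a\<in>A. (a, p i) \<in> B})"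
  have "card N > M" using p(3) assms(5,6) by (auto simp: N_def)
  moreover have "card (p ` {..i}) \<le> M" using Suc.prems card_image_le[of "{..i}" p] by simp
  ultimately have "\<not> N \<subseteq> p ` {..i}" by (metis card_mono finite_atMost finite_imageI le_trans not_le)
  then obtain v where v: "v \<in> N" "v \<notin> p ` {..i}" by blast
  let ?p = "p(Suc i := v)"
  have "inj_on ?p {..Suc i}"
    using p(2) v(2) by (auto simp: inj_on_def le_Suc_eq)
  moreover have "\<forall>j\<le>Suc i. ?p j \<in> (if even j then A else Y)"
    using p(3) v(1) by (auto simp: N_def le_Suc_eq split: if_splits)
  moreover have "\<forall>j<Suc i. (?p j, ?p (Suc j)) \<in> B \<or> (?p (Suc j), ?p j) \<in> B"
    using p(4) v(1) by (auto simp: N_def less_Suc_eq split: if_splits)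
  moreover have "?p 0 = a\<^sub>0" using p(1) by simp
  ultimately show ?case by (intro exI[of _ ?p] conjI)
qed

section \<open>Cycles through a levelled tree\<close>

definition has_cycle :: "('a \<Rightarrow> 'a \<Rightarrow> bool) \<Rightarrow> nat \<Rightarrow> bool" where
  "has_cycle adj n \<longleftrightarrow> (\<exists>x. inj_on x {..<n} \<and> (\<forall>i<n. adj (x i) (x (Suc i mod n))))"

text \<open>Depth and parent of the vertices reached by a breadth first search; \<open>adj\<close>
  may have edges besides those of the tree.\<close>

locale levelled_tree =
  fixes adj :: "'a \<Rightarrow> 'a \<Rightarrow> bool" and V :: "'a set" and lev :: "'a \<Rightarrow> nat" and par :: "'a \<Rightarrow> 'a"
  assumes adj_sym: "adj x y \<Longrightarrow> adj y x"
    and par: "v \<in> V \<Longrightarrow> lev v > 0 \<Longrightarrow> par v \<in> V \<and> adj v (par v) \<and> lev v = Suc (lev (par v))"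
begin

lemma par_power: "v \<in> V \<Longrightarrow> i \<le> lev v \<Longrightarrow> (par ^^ i) v \<in> V \<and> lev ((par ^^ i) v) = lev v - i"
proof (induction i)
  case (Suc i)
  then have "(par ^^ i) v \<in> V" "lev ((par ^^ i) v) = lev v - i" by auto
  with par[of "(par ^^ i) v"] Suc.prems show ?case by auto
qed auto

lemma adj_par_power: "v \<in> V \<Longrightarrow> i < lev v \<Longrightarrow> adj ((par ^^ i) v) ((par ^^ Suc i) v)"
  using par_power[of v i] par[of "(par ^^ i) v"] by auto

text \<open>The cycle runs along \<open>p\<close>, climbs from its end to the common ancestor
  \<open>Suc h\<close> levels up, and descends to its start. Since \<open>p\<close> stays on levels
  at least \<open>j\<close> and the rest lies on smaller levels, a repetition could only occur
  between the two branches.\<close>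

lemma has_cycle_through_tree:
  assumes p: "inj_on p {..2 * m}" "\<And>i. i \<le> 2 * m \<Longrightarrow> lev (p i) \<ge> j"
      "\<And>i. i < 2 * m \<Longrightarrow> adj (p i) (p (Suc i))"
    and ends: "p 0 \<in> V" "lev (p 0) = j" "p (2 * m) \<in> V" "lev (p (2 * m)) = j" and "h < j"
    and top: "(par ^^ Suc h) (p 0) = (par ^^ Suc h) (p (2 * m))"
    and branch: "(par ^^ h) (p 0) \<noteq> (par ^^ h) (p (2 * m))"
  shows "has_cycle adj (2 * m + 2 * Suc h)"
proof -
  define n where "n = 2 * m + 2 * Suc h"
  define x where "x i = (if i \<le> 2 * m then p i else if i \<le> 2 * m + Suc h then (par ^^ (i - 2 * m)) (p (2 * m))
    else (par ^^ (n - i)) (p 0))" for i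
  \<comment> \<open>The formulas agree at the joints of the three arcs, so each of them holds on a
    closed interval of indices.\<close>
  have x1: "x i = p i" if "i \<le> 2 * m" for i using that by (simp add: x_def)
  have x2: "x i = (par ^^ (i - 2 * m)) (p (2 * m))" if "2 * m \<le> i" "i \<le> 2 * m + Suc h" for i
    using that by (cases "i = 2 * m") (simp_all add: x_def)
  have x3: "x i = (par ^^ (n - i)) (p 0)" if "2 * m + Suc h \<le> i" for i
  proof (cases "i = 2 * m + Suc h")
    case True
    then have "x i = (par ^^ Suc h) (p (2 * m))" "n - i = Suc h"
      using x2[of i] by (simp_all add: n_def)
    then show ?thesis using top by simp
  qed (use that in \<open>simp add: x_def\<close>)
  have l1: "lev (x i) \<ge> j" if "i \<le> 2 * m" for i using that p(2) x1 by simp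
  have l2: "lev (x i) = j - (i - 2 * m)" if "2 * m \<le> i" "i \<le> 2 * m + Suc h" for i
    using par_power[OF ends(3), of "i - 2 * m"] x2[OF that] ends(4) \<open>h < j\<close> that by simp
  have l3: "lev (x i) = j - (n - i)" if "2 * m + Suc h \<le> i" for i
    using par_power[OF ends(1), of "n - i"] x3[OF that] ends(2) \<open>h < j\<close> that by (simp add: n_def)
  \<comment> \<open>Equal levels put both vertices at the same height \<open>e \<le> h\<close> above
    the ends of \<open>p\<close>; climbing \<open>h - e\<close> further would identify the branches
    at height \<open>h\<close>.\<close>
  have cross: False if eq: "x i = x i'" and i: "2 * m < i" "i \<le> 2 * m + Suc h" and i': "2 * m + Suc h < i'" "i' < n" for i i'
  proof -
    have "j - (i - 2 * m) = j - (n - i')" using l2[of i] l3[of i'] eq i i' by simp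
    then have e: "i - 2 * m = n - i'" using \<open>h < j\<close> i i' by (simp add: n_def)
    define e where "e = n - i'"
    have "e \<le> h" using i' by (simp add: e_def n_def)
    have "(par ^^ e) (p (2 * m)) = (par ^^ e) (p 0)"
      using x2[of i] x3[of i'] eq i i' e by (simp add: e_def)
    then have "(par ^^ (h - e)) ((par ^^ e) (p (2 * m))) = (par ^^ (h - e)) ((par ^^ e) (p 0))" by simp
    then have "(par ^^ (h - e + e)) (p (2 * m)) = (par ^^ (h - e + e)) (p 0)"
      unfolding funpow_add o_def .
    then show False using branch \<open>e \<le> h\<close> by simp
  qed
  have inj: "inj_on x {..<n}"
  proof (rule linorder_inj_onI)
    fix i i' assume ii: "i < i'" "i \<in> {..<n}" "i' \<in> {..<n}"
    show "x i \<noteq> x i'"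
    proof
      assume eq: "x i = x i'"
      consider "i' \<le> 2 * m" | "i \<le> 2 * m" "2 * m < i'" "i' \<le> 2 * m + Suc h" | "i \<le> 2 * m" "2 * m + Suc h < i'"
        | "2 * m < i" "i' \<le> 2 * m + Suc h" | "2 * m < i" "i \<le> 2 * m + Suc h" "2 * m + Suc h < i'"
        | "2 * m + Suc h < i" using ii(1) by linarith
      then show False
      proof cases
        case 1
        then have "p i = p i'" using x1 eq ii(1) by simp
        then show False using p(1) 1 ii(1) by (auto simp: inj_on_def)
      next
        case 2
        then show False using l1[of i] l2[of i'] eq \<open>h < j\<close> by simp
      next
        case 3
        then show False using l1[of i] l3[of i'] eq \<open>h < j\<close> ii(3) by (simp add: n_def)
      next
        case 4
        then show False using l2[of i] l2[of i'] eq \<open>h < j\<close> ii(1) by simp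
      next
        case 5
        then show False using cross[OF eq] ii(3) by simp
      next
        case 6
        then show False using l3[of i] l3[of i'] eq \<open>h < j\<close> ii by (simp add: n_def)
      qed
    qed
  qed auto
  have "adj (x i) (x (Suc i mod n))" if "i < n" for i
  proof -
    consider "i < 2 * m" | "2 * m \<le> i" "i < 2 * m + Suc h" | "2 * m + Suc h \<le> i" by linarith
    then show ?thesis
    proof cases
      case 1
      then show ?thesis using x1 p(3) by (simp add: n_def)
    next
      case 2
      then show ?thesis
        using x2[of i] x2[of "Suc i"] adj_par_power[OF ends(3), of "i - 2 * m"] ends(4) \<open>h < j\<close>
        by (simp add: n_def Suc_diff_le)
    next
      case 3
      have "x (Suc i mod n) = (par ^^ (n - Suc i)) (p 0)"
      proof (cases "Suc i = n")
        case True
        then show ?thesis using x1[of 0] by simp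
      next
        case False
        then show ?thesis using x3[of "Suc i"] 3 that by simp
      qed
      moreover have "x i = (par ^^ Suc (n - Suc i)) (p 0)"
        using x3[OF 3] that by (metis Suc_diff_Suc)
      moreover have "n - Suc i < lev (p 0)" using 3 ends(2) \<open>h < j\<close> by (simp add: n_def)
      ultimately show ?thesis using adj_sym[OF adj_par_power[OF ends(1)]] by simp
    qed
  qed
  with inj show ?thesis unfolding has_cycle_def n_def by blast
qed

text \<open>Induction on the height \<open>h\<close>. Within the subtrees of the children of \<open>z\<close> the bound holds
  by induction, so if it fails at \<open>z\<close>, then keeping a single edge from each vertex of \<open>Y\<close> to each
  of these subtrees still leaves a dense graph. In that graph a long path can be extended to a vertex
  lying below another child of \<open>z\<close> than its start, and it closes up through \<open>z\<close> to
  a cycle of length \<open>2 l\<close>.\<close>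

lemma card_edges_between_levels_le:
  assumes "\<not> has_cycle adj (2 * l)" "h < l" "h \<le> j"
    and "finite A" "finite Y" "A \<subseteq> V" "\<And>a. a \<in> A \<Longrightarrow> lev a = j \<and> (par ^^ h) a = z"
    and "\<And>y. y \<in> Y \<Longrightarrow> lev y = Suc j" "B \<subseteq> A \<times> Y" "\<And>a y. (a, y) \<in> B \<Longrightarrow> adj a y"
  shows "card B \<le> (2 * l + 2) ^ h * (card A + card Y)"
  using assms(2-)
proof (induction h arbitrary: z A Y B)
  case 0
  then have "A \<subseteq> {z}" by auto
  then have "B \<subseteq> Pair z ` Y" using "0.prems"(8) by auto
  then have "card B \<le> card (Pair z ` Y)" using "0.prems"(4) by (intro card_mono) auto
  also have "\<dots> = card Y" by (simp add: card_image inj_on_def)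
  finally show ?case by simp
next
  case (Suc h)
  note finA = Suc.prems(3) and finY = Suc.prems(4) and AV = Suc.prems(5) and A = Suc.prems(6)
    and Y = Suc.prems(7) and B = Suc.prems(8) and Badj = Suc.prems(9)
  \<comment> \<open>\<open>c a\<close> is the child of \<open>z\<close> above \<open>a\<close>.
    \<open>B'\<close> keeps exactly one edge of \<open>B\<close> for each child and each vertex of
    \<open>Y\<close> joined to the subtree of that child.\<close>
  define c where "c = par ^^ h"
  define g where "g = (\<lambda>(a, y). (c a, y :: 'a))"
  have finB: "finite B" using B finA finY by (meson finite_SigmaI finite_subset)
  obtain B' where B': "B' \<subseteq> B" "inj_on g B'" "g ` B = g ` B'"
    using subset_image_inj[of "g ` B" g B] by auto
  have B'_le: "card B' \<le> (2 * l + 1) * (card A + card Y)"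
  proof (rule ccontr)
    assume "\<not> ?thesis"
    then have "card B' > (2 * l + 1) * (card A + card Y)" by simp
    from bipartite_min_degree_subgraph[OF finA finY subset_trans[OF B'(1) B] this]
    obtain A' Y' where AY': "A' \<subseteq> A" "Y' \<subseteq> Y" "B' \<inter> A' \<times> Y' \<noteq> {}"
      "\<And>a. a \<in> A' \<Longrightarrow> card {y\<in>Y'. (a, y) \<in> B'} > 2 * l + 1"
      "\<And>y. y \<in> Y' \<Longrightarrow> card {a\<in>A'. (a, y) \<in> B'} > 2 * l + 1" by blast
    obtain a\<^sub>0 where "a\<^sub>0 \<in> A'" using AY'(3) by blast
    \<comment> \<open>Chosen so that the final cycle has length
      \<open>2 * m + 2 * Suc h = 2 * l\<close>.\<close>
    define m where "m = l - Suc h"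
    have m: "m \<ge> 1" "l = m + Suc h" using Suc.prems(1) by (auto simp: m_def)
    have disj: "A' \<inter> Y' = {}" using A Y AY'(1,2) by fastforce
    have fin': "finite A'" "finite Y'" using AY'(1,2) finA finY finite_subset by blast+
    have "2 * m - 1 \<le> 2 * l + 1" using m by simp
    from bipartite_path_from[OF fin' disj \<open>a\<^sub>0 \<in> A'\<close> AY'(4,5) this]
    obtain p where p: "p 0 = a\<^sub>0" "inj_on p {..2 * m - 1}"
      "\<forall>i\<le>2 * m - 1. p i \<in> (if even i then A' else Y')"
      "\<forall>i<2 * m - 1. (p i, p (Suc i)) \<in> B' \<or> (p (Suc i), p i) \<in> B'" by blast
    \<comment> \<open>More than \<open>2 * l + 1\<close> candidates for the end of the path. At most
      \<open>2 * l\<close> of them are on the path already, and at most one lies below the same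
      child as \<open>a\<^sub>0\<close>, because \<open>B'\<close> has only one edge from
      \<open>p (2 * m - 1)\<close> into that subtree.\<close>
    define N where "N = {a\<in>A'. (a, p (2 * m - 1)) \<in> B'}"
    have "odd (2 * m - 1)" using m(1) by simp
    then have "p (2 * m - 1) \<in> Y'" using p(3) by auto
    then have "card N > 2 * l + 1" using AY'(5) by (simp add: N_def)
    moreover have "card {a\<in>N. c a = c a\<^sub>0} \<le> 1"
    proof -
      have "a = a'" if "a \<in> N" "a' \<in> N" "c a = c a\<^sub>0" "c a' = c a\<^sub>0" for a a'
        using inj_onD[OF B'(2), of "(a, p (2 * m - 1))" "(a', p (2 * m - 1))"] that by (simp add: N_def g_def)
      then show ?thesis using fin' by (auto simp: card_le_Suc0_iff_eq N_def)
    qed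
    moreover have "card (p ` {..2 * m - 1}) \<le> 2 * l"
      using card_image_le[of "{..2 * m - 1}" p] m by simp
    ultimately have "\<not> N \<subseteq> p ` {..2 * m - 1} \<union> {a\<in>N. c a = c a\<^sub>0}"
      using card_mono[of "p ` {..2 * m - 1} \<union> {a\<in>N. c a = c a\<^sub>0}" N]
        card_Un_le[of "p ` {..2 * m - 1}" "{a\<in>N. c a = c a\<^sub>0}"] fin' by (force simp: N_def)
    then obtain v where v: "v \<in> N" "v \<notin> p ` {..2 * m - 1}" "c v \<noteq> c a\<^sub>0" by blast
    define p' where "p' = p(2 * m := v)"
    have le: "i \<le> 2 * m \<longleftrightarrow> i \<le> 2 * m - 1 \<or> i = 2 * m" for i using m by auto
    have p'0: "p' 0 = a\<^sub>0" using m p by (simp add: p'_def)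
    have p'm: "p' (2 * m) = v" by (simp add: p'_def)
    have "v \<in> A'" "(v, p (2 * m - 1)) \<in> B'" using v by (auto simp: N_def)
    have "has_cycle adj (2 * m + 2 * Suc h)"
    proof (rule has_cycle_through_tree[where p = p' and j = j])
      show "inj_on p' {..2 * m}"
        using p(2) v(2) m by (auto simp: inj_on_def p'_def le)
      show "lev (p' i) \<ge> j" if "i \<le> 2 * m" for i
      proof (cases "i = 2 * m")
        case True
        then show ?thesis using A AY'(1) \<open>v \<in> A'\<close> by (auto simp: p'_def)
      next
        case False
        then have "p i \<in> A' \<union> Y'" using p(3) that m by (auto split: if_splits simp: le)
        then show ?thesis using False A Y AY'(1,2) by (auto simp: p'_def)
      qed
      show "adj (p' i) (p' (Suc i))" if "i < 2 * m" for i
      proof (cases "i = 2 * m - 1")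
        case True
        then have "p' i = p (2 * m - 1)" "p' (Suc i) = v" using m by (auto simp: p'_def)
        then show ?thesis using \<open>(v, p (2 * m - 1)) \<in> B'\<close> B'(1) Badj adj_sym by auto
      next
        case False
        then have "p' i = p i" "p' (Suc i) = p (Suc i)" "i < 2 * m - 1" using that by (auto simp: p'_def)
        then show ?thesis using p(4) B'(1) Badj adj_sym by (metis subsetD)
      qed
    qed (use p'0 p'm A AV AY'(1) \<open>v \<in> A'\<close> \<open>a\<^sub>0 \<in> A'\<close> v(3) Suc.prems(2) in \<open>auto simp: c_def\<close>)
    then show False using assms(1) m by simp
  qed
  define C where "C = c ` A"
  have finC: "finite C" using finA by (simp add: C_def)
  define Ac where "Ac k = {a\<in>A. c a = k}" for k
  define Bc where "Bc k = {e\<in>B. c (fst e) = k}" for k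
  define Yc where "Yc k = snd ` Bc k" for k
  have "card B \<le> (\<Sum>k\<in>C. card (Bc k))"
  proof -
    have "(\<Sum>k\<in>C. card (Bc k)) = card B"
      unfolding Bc_def card_eq_sum using finB finC B by (intro sum.group) (auto simp: C_def)
    then show ?thesis by simp
  qed
  also have "\<dots> \<le> (\<Sum>k\<in>C. (2 * l + 2) ^ h * (card (Ac k) + card (Yc k)))"
  proof (rule sum_mono)
    fix k assume "k \<in> C"
    show "card (Bc k) \<le> (2 * l + 2) ^ h * (card (Ac k) + card (Yc k))"
    proof (rule Suc.IH)
      show "Bc k \<subseteq> Ac k \<times> Yc k" using B by (force simp: Bc_def Ac_def Yc_def)
      show "finite (Yc k)" using finB by (simp add: Yc_def Bc_def)
      show "lev y = Suc j" if "y \<in> Yc k" for y using that B Y by (auto simp: Yc_def Bc_def)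
    qed (use Suc.prems(1,2) finA AV A Badj in \<open>auto simp: Ac_def Bc_def c_def\<close>)
  qed
  also have "\<dots> = (2 * l + 2) ^ h * ((\<Sum>k\<in>C. card (Ac k)) + (\<Sum>k\<in>C. card (Yc k)))"
    by (simp only: sum_distrib_left[symmetric] sum.distrib)
  also have "(\<Sum>k\<in>C. card (Ac k)) = card A"
    unfolding Ac_def card_eq_sum using finA finC by (intro sum.group) (auto simp: C_def)
  \<comment> \<open>A vertex of \<open>Y\<close> is counted once for each subtree that it is joined
    to, and these pairs form the image of \<open>B\<close> under \<open>g\<close>.\<close>
  also have "(\<Sum>k\<in>C. card (Yc k)) = card B'"
  proof -
    have "card (Yc k) = card {r\<in>g ` B. fst r = k}" for k
    proof -
      have "{r\<in>g ` B. fst r = k} = Pair k ` Yc k" by (force simp: g_def Yc_def Bc_def)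
      then show ?thesis by (simp add: card_image inj_on_def)
    qed
    then have "(\<Sum>k\<in>C. card (Yc k)) = (\<Sum>k\<in>C. card {r\<in>g ` B. fst r = k})" by simp
    also have "\<dots> = card (g ` B)"
      unfolding card_eq_sum using finB finC B by (intro sum.group) (auto simp: C_def g_def)
    also have "\<dots> = card B'" using B'(2,3) by (simp add: card_image)
    finally show ?thesis .
  qed
  also have "(2 * l + 2) ^ h * (card A + card B') \<le> (2 * l + 2) ^ h * (card A + (2 * l + 1) * (card A + card Y))"
    using B'_le by (intro mult_le_mono2) simp
  also have "\<dots> \<le> (2 * l + 2) ^ h * ((2 * l + 2) * (card A + card Y))"
    by (intro mult_le_mono2) simp
  finally show ?case by (simp only: power_Suc ac_simps)
qed

end

section \<open>Growth of the levels in a breadth first search\<close>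

lemma has_cycle_mono: "has_cycle adj n \<Longrightarrow> (\<And>x y. adj x y \<Longrightarrow> adj' x y) \<Longrightarrow> has_cycle adj' n"
  unfolding has_cycle_def by blast

text \<open>Search a subgraph of large minimum degree from a vertex \<open>r\<close>. Without the
  cycle there are few edges between consecutive levels, so up to level \<open>l\<close> each level
  is at least \<open>t\<close> times as large as the one before, and level \<open>l\<close> has at
  least \<open>t ^ l\<close> vertices.\<close>

lemma bipartite_dense_even_cycle:
  fixes B :: "('a \<times> 'a) set"
  assumes fin: "finite U" "finite W" and UW: "U \<inter> W = {}" and B: "B \<subseteq> U \<times> W"
    and no_cycle: "\<not> has_cycle (\<lambda>x y. (x, y) \<in> B \<or> (y, x) \<in> B) (2 * l)" and "t \<ge> 1"
    and dense: "card B > (2 * l + 2) ^ l * (t + 3) * (card U + card W)"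
  shows "t ^ l \<le> card U + card W"
proof -
  define D where "D = (2 * l + 2) ^ l"
  \<comment> \<open>Divided by \<open>D\<close>, counting the edges at level \<open>i + 1\<close>
    gives \<open>(t + 3) * card (L (i + 1))\<close> on one side and
    \<open>2 * card (L (i + 1)) + card (L i) + card (L (i + 2))\<close> on the other. The 3 absorbs
    the first two terms since levels do not shrink.\<close>
  define M where "M = D * (t + 3)"
  have "D > 0" by (simp add: D_def)
  have "card B > M * (card U + card W)" using dense by (simp add: M_def D_def)
  from bipartite_min_degree_subgraph[OF fin B this]
  obtain U' W' where UW': "U' \<subseteq> U" "W' \<subseteq> W" "B \<inter> U' \<times> W' \<noteq> {}"
    and deg: "\<And>a. a \<in> U' \<Longrightarrow> card {y\<in>W'. (a, y) \<in> B} > M" "\<And>y. y \<in> W' \<Longrightarrow> card {a\<in>U'. (a, y) \<in> B} > M"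
    by blast
  have fin': "finite U'" "finite W'" using UW'(1,2) fin finite_subset by blast+
  have disj: "U' \<inter> W' = {}" using UW UW'(1,2) by blast
  obtain r where r: "r \<in> U'" using UW'(3) by blast
  define adj where "adj x y \<longleftrightarrow> (x, y) \<in> B \<inter> U' \<times> W' \<or> (y, x) \<in> B \<inter> U' \<times> W'" for x y
  have adj_sym: "adj x y \<Longrightarrow> adj y x" for x y by (auto simp: adj_def)
  have adj_flip: "adj x y \<Longrightarrow> x \<in> U' \<union> W' \<and> y \<in> U' \<union> W' \<and> (x \<in> U' \<longleftrightarrow> y \<notin> U')" for x y
    using disj by (auto simp: adj_def)
  have deg_adj: "card {y. adj x y} > M" if "x \<in> U' \<union> W'" for x
  proof (cases "x \<in> U'")
    case True
    then have "{y. adj x y} = {y\<in>W'. (x, y) \<in> B}" using disj by (auto simp: adj_def)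
    then show ?thesis using deg True by simp
  next
    case False
    then have "{y. adj x y} = {a\<in>U'. (a, x) \<in> B}" "x \<in> W'" using that by (auto simp: adj_def)
    then show ?thesis using deg by simp
  qed
  have no_cycle': "\<not> has_cycle adj (2 * l)"
    using no_cycle has_cycle_mono[of adj "2 * l" "\<lambda>x y. (x, y) \<in> B \<or> (y, x) \<in> B"] by (auto simp: adj_def)
  define R where "R = {(x, y). adj x y}"
  define V where "V = {v. \<exists>i. (r, v) \<in> R ^^ i}"
  define lev where "lev v = (LEAST i. (r, v) \<in> R ^^ i)" for v
  have lev: "(r, v) \<in> R ^^ lev v" if "v \<in> V" for v
    using that unfolding V_def lev_def by (auto intro: LeastI)
  have lev_le: "lev v \<le> i" if "(r, v) \<in> R ^^ i" for v i
    using that unfolding lev_def by (rule Least_le)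
  \<comment> \<open>The parity of the distance determines the side, so no edge joins two vertices of
    the same level.\<close>
  have parity: "v \<in> U' \<union> W' \<and> (v \<in> U' \<longleftrightarrow> even i)" if "(r, v) \<in> R ^^ i" for v i
    using that
  proof (induction i arbitrary: v)
    case 0
    then show ?case using r by simp
  next
    case (Suc i)
    then obtain u where "(r, u) \<in> R ^^ i" "adj u v" by (auto simp: R_def)
    then show ?case using Suc.IH adj_flip by auto
  qed
  have V_sub: "V \<subseteq> U' \<union> W'" using parity by (auto simp: V_def)
  have finV: "finite V" using V_sub fin' finite_subset by blast
  have lev_Suc: "y \<in> V \<and> lev y \<le> Suc (lev x)" if "x \<in> V" "adj x y" for x y
  proof -
    have "(r, y) \<in> R ^^ Suc (lev x)" using lev[OF that(1)] that(2) by (auto simp: R_def)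
    then show ?thesis using lev_le by (auto simp: V_def simp del: relpow.simps)
  qed
  have lev_adj: "lev y = Suc (lev x) \<or> lev x = Suc (lev y)" if "x \<in> V" "adj x y" for x y
  proof -
    have y: "y \<in> V" "lev y \<le> Suc (lev x)" using lev_Suc[OF that] by auto
    have "lev x \<le> Suc (lev y)" using lev_Suc[OF y(1) adj_sym[OF that(2)]] by simp
    moreover have "even (lev x) \<noteq> even (lev y)"
      using parity[OF lev[OF that(1)]] parity[OF lev[OF y(1)]] adj_flip[OF that(2)] by blast
    ultimately show ?thesis using y(2) by (metis le_Suc_eq le_antisym)
  qed
  have lev0: "v = r" if "v \<in> V" "lev v = 0" for v using lev[OF that(1)] that(2) by simp
  have ex_par: "\<exists>u. u \<in> V \<and> adj v u \<and> lev v = Suc (lev u)" if v: "v \<in> V" "lev v > 0" for v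
  proof -
    obtain k where k: "lev v = Suc k" using v(2) gr0_implies_Suc by blast
    then obtain u where u: "(r, u) \<in> R ^^ k" "adj u v" using lev[OF v(1)] by (auto simp: R_def)
    then have "u \<in> V" "lev u \<le> k" using lev_le by (auto simp: V_def)
    then show ?thesis using lev_adj[OF \<open>u \<in> V\<close> u(2)] k adj_sym[OF u(2)] by auto
  qed
  define par where "par v = (SOME u. u \<in> V \<and> adj v u \<and> lev v = Suc (lev u))" for v
  interpret levelled_tree adj V lev par
  proof
    show "par v \<in> V \<and> adj v (par v) \<and> lev v = Suc (lev (par v))" if "v \<in> V" "lev v > 0" for v
      unfolding par_def using someI_ex[OF ex_par[OF that]] .
  qed (fact adj_sym)
  define L where "L i = {v\<in>V. lev v = i}" for i
  define E where "E i = {(x, y). x \<in> L i \<and> y \<in> L (Suc i) \<and> adj x y}" for i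
  have finL: "finite (L i)" for i using finV by (simp add: L_def)
  have E_sub: "E i \<subseteq> L i \<times> L (Suc i)" for i by (auto simp: E_def)
  have finE: "finite (E i)" for i using E_sub finL by (meson finite_SigmaI finite_subset)
  \<comment> \<open>The \<open>i\<close>-th ancestor of every vertex of level \<open>i\<close> is
    \<open>r\<close>, so the tree bound applies with \<open>h = j = i\<close> and
    \<open>z = r\<close>.\<close>
  have E_le: "card (E i) \<le> D * (card (L i) + card (L (Suc i)))" if "i < l" for i
  proof -
    have "(par ^^ i) a = r" if "a \<in> L i" for a
      using par_power[of a i] lev0[of "(par ^^ i) a"] that by (simp add: L_def)
    then have "card (E i) \<le> (2 * l + 2) ^ i * (card (L i) + card (L (Suc i)))"
      by (intro card_edges_between_levels_le[OF no_cycle' \<open>i < l\<close> order_refl finL finL _ _ _ E_sub])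
        (auto simp: L_def E_def)
    also have "\<dots> \<le> D * (card (L i) + card (L (Suc i)))"
      unfolding D_def using \<open>i < l\<close> by (intro mult_le_mono1 power_increasing) auto
    finally show ?thesis .
  qed
  have finN: "finite {y. adj x y}" for x
    by (rule finite_subset[of _ "U' \<union> W'"]) (use adj_flip fin' in auto)
  have deg_sum: "M * card (L i) \<le> card (Sigma (L i) (\<lambda>x. {y. adj x y}))" for i
  proof -
    have "M * card (L i) = (\<Sum>x\<in>L i. M)" by simp
    also have "\<dots> \<le> (\<Sum>x\<in>L i. card {y. adj x y})"
      using deg_adj V_sub by (intro sum_mono less_imp_le) (auto simp: L_def)
    finally show ?thesis using finL finN by simp
  qed
  have grow: "t * card (L i) \<le> card (L (Suc i))" if "i < l" for i
    using that
  proof (induction i)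
    case 0
    have "Sigma (L 0) (\<lambda>x. {y. adj x y}) \<subseteq> E 0"
      using lev_adj lev_Suc by (fastforce simp: E_def L_def)
    then have "M * card (L 0) \<le> D * (card (L 0) + card (L 1))"
      using deg_sum[of 0] E_le[OF "0.prems"] card_mono[OF finE] by (metis One_nat_def le_trans)
    then have "(t + 3) * card (L 0) \<le> card (L 0) + card (L 1)"
      using \<open>D > 0\<close> unfolding M_def mult.assoc by simp
    then show ?case by (simp add: algebra_simps)
  next
    case (Suc i)
    have "Sigma (L (Suc i)) (\<lambda>x. {y. adj x y}) \<subseteq> E (Suc i) \<union> prod.swap ` E i"
    proof
      fix e assume "e \<in> Sigma (L (Suc i)) (\<lambda>x. {y. adj x y})"
      then obtain x y where e: "e = (x, y)" "x \<in> V" "lev x = Suc i" "adj x y" by (auto simp: L_def)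
      then have "y \<in> V" "lev y = Suc (Suc i) \<or> lev y = i" using lev_adj[of x y] lev_Suc[of x y] by auto
      then show "e \<in> E (Suc i) \<union> prod.swap ` E i"
        using e adj_sym[OF e(4)] by (auto simp: E_def L_def)
    qed
    then have "M * card (L (Suc i)) \<le> card (E (Suc i) \<union> prod.swap ` E i)"
      using deg_sum[of "Suc i"] card_mono[of "E (Suc i) \<union> prod.swap ` E i"] finE
      by (meson finite_UnI finite_imageI le_trans)
    also have "\<dots> \<le> card (E (Suc i)) + card (E i)"
      using card_Un_le card_image_le[OF finE] by (metis add_left_mono le_trans)
    also have "\<dots> \<le> D * (card (L (Suc i)) + card (L (Suc (Suc i)))) + D * (card (L i) + card (L (Suc i)))"
      using E_le Suc.prems by (intro add_mono) auto
    finally have "D * ((t + 3) * card (L (Suc i))) \<le>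
      D * (2 * card (L (Suc i)) + card (L i) + card (L (Suc (Suc i))))"
      by (simp add: M_def algebra_simps)
    then have "(t + 3) * card (L (Suc i)) \<le> 2 * card (L (Suc i)) + card (L i) + card (L (Suc (Suc i)))"
      using \<open>D > 0\<close> by simp
    moreover have "card (L i) \<le> card (L (Suc i))"
      using Suc.IH Suc.prems mult_le_mono1[OF \<open>t \<ge> 1\<close>, of "card (L i)"] by linarith
    ultimately show ?case by (simp add: algebra_simps)
  qed
  have "t ^ i \<le> card (L i)" if "i \<le> l" for i
    using that
  proof (induction i)
    case 0
    have "(r, r) \<in> R ^^ 0" by simp
    then have "r \<in> V" "lev r = 0" using lev_le[of r 0] unfolding V_def by blast+
    then have "r \<in> L 0" by (simp add: L_def)
    then have "L 0 \<noteq> {}" by blast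
    then show ?case using finL card_gt_0_iff[of "L 0"] by (simp add: Suc_le_eq)
  next
    case (Suc i)
    then have "t * t ^ i \<le> t * card (L i)" by (intro mult_le_mono2) simp
    also have "\<dots> \<le> card (L (Suc i))" using grow[of i] Suc.prems by simp
    finally show ?case by simp
  qed
  then have "t ^ l \<le> card (L l)" by simp
  also have "\<dots> \<le> card (U' \<union> W')" using V_sub fin' by (intro card_mono) (auto simp: L_def)
  also have "\<dots> \<le> card U + card W"
    using card_Un_le[of U' W'] card_mono[OF fin(1) UW'(1)] card_mono[OF fin(2) UW'(2)] by linarith
  finally show ?thesis .
qed

section \<open>The upper bound\<close>

lemma theta_verts: "uverts (theta_graph s k) = (\<lambda>(i, j). theta_path k i j) ` ({..<s} \<times> {..k})"
  and theta_edges: "uedges (theta_graph s k) = (\<lambda>(i, j). {theta_path k i j, theta_path k i (Suc j)}) ` ({..<s} \<times> {..<k})"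
  by (auto simp: theta_graph_def)

lemma finite_theta_verts: "finite (uverts (theta_graph s k))"
  by (simp add: theta_verts)

text \<open>The paths form a copy \<open>G\<close> of the theta graph. The edge \<open>uv\<close> is
  not in it because \<open>k \<ge> 2\<close>, so adding it gives a subgraph \<open>F\<close> of
  \<open>H\<close> on the same vertices that contains the theta graph properly.\<close>

lemma admissible_no_disjoint_paths:
  fixes H :: "'a ugraph"
  assumes H: "fin_simple_graph H" "st_admissible H (theta_graph s k)" and "k \<ge> 2" "s \<ge> 1"
    and uv: "{u, v} \<in> uedges H"
    and Z: "\<And>i. i < s \<Longrightarrow> inj_on (Z i) {..k} \<and> Z i 0 = u \<and> Z i k = v \<and> (\<forall>j<k. {Z i j, Z i (Suc j)} \<in> uedges H)"
    and disj: "\<And>i i' j j'. i < s \<Longrightarrow> i' < s \<Longrightarrow> i \<noteq> i' \<Longrightarrow> j \<in> {0<..<k} \<Longrightarrow> j' \<in> {0<..<k} \<Longrightarrow> Z i j \<noteq> Z i' j'"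
  shows False
proof -
  define f where "f w = (case w of Left_End \<Rightarrow> u | Right_End \<Rightarrow> v | Inner i j \<Rightarrow> Z i j)" for w
  define T where "T = theta_graph s k"
  have f: "f (theta_path k i j) = Z i j" if "i < s" for i j
    using Z[OF that] by (auto simp: f_def theta_path_def)
  have path_eq: "theta_path k i j = theta_path k i' j'"
    if ij: "i < s" "i' < s" "j \<le> k" "j' \<le> k" "Z i j = Z i' j'" for i i' j j'
  proof -
    have ends: "Z i 0 = Z i' 0" "Z i k = Z i' k" using Z that by auto
    have inj: "p = q" if "Z n p = Z n q" "p \<le> k" "q \<le> k" "n < s" for n p q
      using Z[OF that(4)] that by (auto dest: inj_onD)
    show ?thesis
    proof (cases "i = i'")
      case True
      then have "Z i j = Z i j'" using ij(5) by simp
      then have "j = j'" by (rule inj) (use ij in simp_all)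
      then show ?thesis using True by simp
    next
      case False
      then consider "j = 0" | "j = k" | "j' = 0" | "j' = k" using disj[of i i' j j'] ij by fastforce
      then have "j = j' \<and> (j = 0 \<or> j = k)"
      proof cases
        case 1
        then have "Z i' 0 = Z i' j'" using ends(1) ij(5) by metis
        then have "0 = j'" by (rule inj) (use ij(2,4) in simp_all)
        then show ?thesis using 1 by simp
      next
        case 2
        then have "Z i' k = Z i' j'" using ends(2) ij(5) by metis
        then have "k = j'" by (rule inj) (use ij(2,4) in simp_all)
        then show ?thesis using 2 by simp
      next
        case 3
        then have "Z i 0 = Z i j" using ends(1) ij(5) by metis
        then have "0 = j" by (rule inj) (use ij(1,3) in simp_all)
        then show ?thesis using 3 by simp
      next
        case 4
        then have "Z i k = Z i j" using ends(2) ij(5) by metis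
        then have "k = j" by (rule inj) (use ij(1,3) in simp_all)
        then show ?thesis using 4 by simp
      qed
      then show ?thesis by (auto simp: theta_path_def)
    qed
  qed
  have inj: "inj_on f (uverts T)"
  proof (rule inj_onI)
    fix x y assume xy: "x \<in> uverts T" "y \<in> uverts T" "f x = f y"
    then obtain i j i' j' where ij: "x = theta_path k i j" "i < s" "j \<le> k" "y = theta_path k i' j'" "i' < s" "j' \<le> k"
      by (auto simp: T_def theta_verts)
    then have "Z i j = Z i' j'" using xy(3) f by simp
    then show "x = y" unfolding ij(1,4) using ij path_eq by blast
  qed
  define G where "G = \<lparr>uverts = f ` uverts T, uedges = (\<lambda>e. f ` e) ` uedges T\<rparr>"
  define F where "F = \<lparr>uverts = f ` uverts T, uedges = insert {u, v} (uedges G)\<rparr>"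
  have edges_G: "uedges G = (\<lambda>(i, j). {Z i j, Z i (Suc j)}) ` ({..<s} \<times> {..<k})"
    unfolding G_def T_def theta_edges by (auto simp: image_image f intro!: image_cong split: prod.splits)
  have edges_G_H: "uedges G \<subseteq> uedges H" using Z by (auto simp: edges_G)
  have verts_G: "uverts G = (\<lambda>(i, j). Z i j) ` ({..<s} \<times> {..k})"
    unfolding G_def T_def theta_verts by (auto simp: image_image f intro!: image_cong split: prod.splits)
  have "Z 0 0 \<in> uverts G" "Z 0 k \<in> uverts G"
    unfolding verts_G using \<open>s \<ge> 1\<close> by force+
  then have uvG: "u \<in> uverts G" "v \<in> uverts G" using Z[of 0] \<open>s \<ge> 1\<close> by auto
  have finG: "fin_simple_graph G"
    unfolding fin_simple_graph_def
  proof (intro conjI ballI)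
    show "finite (uverts G)" using finite_theta_verts by (simp add: G_def T_def)
    fix e assume "e \<in> uedges G"
    then show "e \<subseteq> uverts G" unfolding edges_G verts_G by force
    show "card e = 2" using \<open>e \<in> uedges G\<close> edges_G_H H(1) by (auto simp: fin_simple_graph_def)
  qed
  then have finF: "fin_simple_graph F"
    using uvG H(1) uv by (auto simp: F_def G_def fin_simple_graph_def)
  have "Z i j \<in> uverts H" if "i < s" "j \<le> k" for i j
  proof -
    define e where "e = (if j = k then {u, v} else {Z i j, Z i (Suc j)})"
    have "e \<in> uedges H" "Z i j \<in> e" using that Z uv by (auto simp: e_def)
    then show ?thesis using H(1) unfolding fin_simple_graph_def by blast
  qed
  then have "uverts G \<subseteq> uverts H" unfolding verts_G by auto
  then have "is_subgraph F H"
    using finF H(1) edges_G_H uv by (auto simp: is_subgraph_def F_def G_def)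
  moreover have "card (uverts F) = card (uverts T)" using inj by (simp add: F_def card_image)
  moreover have "contains_properly F T"
  proof -
    have "{u, v} \<notin> uedges G"
    proof
      assume "{u, v} \<in> uedges G"
      then obtain i j where ij: "i < s" "j < k" "{u, v} = {Z i j, Z i (Suc j)}" by (auto simp: edges_G)
      then have "Z i 0 \<in> {Z i j, Z i (Suc j)}" "Z i k \<in> {Z i j, Z i (Suc j)}" using Z by auto
      then have "0 \<in> {j, Suc j}" "k \<in> {j, Suc j}"
        using ij Z[of i] by (auto dest: inj_onD)
      then show False using \<open>k \<ge> 2\<close> by auto
    qed
    moreover have "{u, v} \<in> uedges F" by (simp add: F_def)
    ultimately have "G \<noteq> F" by metis
    moreover have "is_subgraph G F" using finG finF by (auto simp: is_subgraph_def F_def G_def)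
    moreover have "graph_iso T G"
      unfolding graph_iso_def using inj by (intro exI[of _ f]) (auto simp: G_def bij_betw_def)
    ultimately show ?thesis unfolding contains_properly_def by blast
  qed
  ultimately show False using H(2) by (auto simp: st_admissible_def T_def)
qed

text \<open>\<open>W\<close> consists of the inner vertices of a family of internally disjoint paths
  of largest size, which has fewer than \<open>s\<close> members. A path avoiding \<open>W\<close>
  would enlarge the family.\<close>

lemma admissible_path_blocker:
  fixes H :: "'a ugraph"
  assumes H: "fin_simple_graph H" "st_admissible H (theta_graph s k)" and "k \<ge> 2" "s \<ge> 1"
    and uv: "{u, v} \<in> uedges H"
  shows "\<exists>W. W \<subseteq> uverts H \<and> card W \<le> s * k \<and> u \<notin> W \<and> v \<notin> W \<and>
    (\<forall>x. inj_on x {..k} \<and> x 0 = u \<and> x k = v \<and> (\<forall>i<k. {x i, x (Suc i)} \<in> uedges H) \<longrightarrow> (\<exists>i\<in>{0<..<k}. x i \<in> W))"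
proof -
  define P where "P x \<longleftrightarrow> inj_on x {..k} \<and> x 0 = u \<and> x k = v \<and> (\<forall>i<k. {x i, x (Suc i)} \<in> uedges H)" for x
  define fam where "fam m Z \<longleftrightarrow> (\<forall>i<m. P (Z i)) \<and>
    (\<forall>i<m. \<forall>i'<m. i \<noteq> i' \<longrightarrow> (\<forall>j\<in>{0<..<k}. \<forall>j'\<in>{0<..<k}. Z i j \<noteq> Z i' j'))" for m and Z :: "nat \<Rightarrow> nat \<Rightarrow> 'a"
  have no_fam: "\<not> fam s Z" for Z
    using admissible_no_disjoint_paths[OF H assms(3,4) uv, of Z] unfolding fam_def P_def by blast
  have "\<exists>m<s. (\<exists>Z. fam m Z) \<and> (\<nexists>Z. fam (Suc m) Z)"
  proof (rule ccontr)
    assume *: "\<not> ?thesis"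
    have "\<exists>Z. fam m Z" if "m \<le> s" for m
      using that by (induction m) (use * in \<open>auto simp: fam_def[of 0] Suc_le_eq\<close>)
    then show False using no_fam by blast
  qed
  then obtain m Z where m: "m < s" "fam m Z" "\<nexists>Z. fam (Suc m) Z" by blast
  define W where "W = (\<lambda>(i, j). Z i j) ` ({..<m} \<times> {0<..<k})"
  have "card W \<le> m * (k - 1)"
    unfolding W_def using card_image_le[of "{..<m} \<times> {0<..<k}" "\<lambda>(i, j). Z i j"] by simp
  also have "\<dots> \<le> s * k" using m(1) by (intro mult_le_mono) auto
  finally have "card W \<le> s * k" .
  moreover have "W \<subseteq> uverts H"
  proof
    fix w assume "w \<in> W"
    then obtain i j where "i < m" "j < k" "w = Z i j" by (auto simp: W_def)
    then have "w \<in> {Z i j, Z i (Suc j)}" "{Z i j, Z i (Suc j)} \<in> uedges H"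
      using m(2) by (auto simp: fam_def P_def)
    then show "w \<in> uverts H" using H(1) unfolding fin_simple_graph_def by blast
  qed
  moreover have "Z i j \<noteq> u \<and> Z i j \<noteq> v" if "i < m" "j \<in> {0<..<k}" for i j
  proof -
    have "inj_on (Z i) {..k}" "Z i 0 = u" "Z i k = v" using m(2) that by (auto simp: fam_def P_def)
    then show ?thesis using that(2) by (metis atMost_iff greaterThanLessThan_iff inj_onD le0 less_imp_le less_irrefl order_refl)
  qed
  then have "u \<notin> W" "v \<notin> W" by (force simp: W_def)+
  moreover have "\<exists>i\<in>{0<..<k}. x i \<in> W" if "P x" for x
  proof (rule ccontr)
    assume *: "\<not> ?thesis"
    have "fam (Suc m) (Z(m := x))"
      unfolding fam_def
    proof (intro conjI allI impI ballI)
      show "P ((Z(m := x)) i)" if "i < Suc m" for i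
        using that m(2) \<open>P x\<close> by (auto simp: fam_def less_Suc_eq)
      fix i i' j j' assume ij: "i < Suc m" "i' < Suc m" "i \<noteq> i'" "j \<in> {0<..<k}" "j' \<in> {0<..<k}"
      then consider "i < m" "i' < m" | "i = m" "i' < m" | "i < m" "i' = m" by linarith
      then show "(Z(m := x)) i j \<noteq> (Z(m := x)) i' j'"
      proof cases
        case 1
        then show ?thesis using m(2) ij unfolding fam_def by simp
      next
        case 2
        then have "Z i' j' \<in> W" using ij by (auto simp: W_def)
        moreover have "x j \<notin> W" using * ij(4) by blast
        ultimately show ?thesis using 2 by auto
      next
        case 3
        then have "Z i j \<in> W" using ij by (auto simp: W_def)
        moreover have "x j' \<notin> W" using * ij(5) by blast
        ultimately show ?thesis using 3 by auto
      qed
    qed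
    then show False using m(3) by blast
  qed
  ultimately show ?thesis unfolding P_def by blast
qed

section \<open>Colourings that destroy the cycles\<close>

text \<open>Average over all colourings of \<open>V\<close>: a pair in \<open>A\<close> prescribes
  the colours of at most \<open>c + 2\<close> vertices, so it is good for at least a fraction
  \<open>1 / 3 ^ (c + 2)\<close> of them. The proof counts pairs of a colouring and a good element
  of \<open>A\<close> in two ways.\<close>

lemma ex_three_colouring:
  fixes A :: "('a \<times> 'a) set"
  assumes "finite V" "finite A" "A \<subseteq> V \<times> V"
    and W: "\<And>u v. (u, v) \<in> A \<Longrightarrow> u \<noteq> v \<and> W u v \<subseteq> V \<and> card (W u v) \<le> c \<and> u \<notin> W u v \<and> v \<notin> W u v"
  shows "\<exists>col :: 'a \<Rightarrow> nat. card A \<le> 3 ^ (c + 2) *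
    card {(u, v) \<in> A. col u = 0 \<and> col v = 1 \<and> (\<forall>w\<in>W u v. col w = 2)}"
proof (rule ccontr)
  define good where "good col e \<longleftrightarrow> col (fst e) = 0 \<and> col (snd e) = 1 \<and> (\<forall>w\<in>W (fst e) (snd e). col w = 2)"
    for col :: "'a \<Rightarrow> nat" and e
  have good: "{(u, v) \<in> A. col u = 0 \<and> col v = 1 \<and> (\<forall>w\<in>W u v. col w = 2)} = {e\<in>A. good col e}" for col
    by (auto simp: good_def)
  define Cs where "Cs = V \<rightarrow>\<^sub>E {0, 1, 2 :: nat}"
  have finC: "finite Cs" using assms(1) by (simp add: Cs_def finite_PiE)
  have cardC: "card Cs = 3 ^ card V" using assms(1) by (simp add: Cs_def card_PiE numeral_3_eq_3)
  assume "\<not> ?thesis"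
  then have "3 ^ (c + 2) * card {e\<in>A. good col e} < card A" for col
    unfolding good by (simp add: not_le)
  moreover have "Cs \<noteq> {}" using cardC by auto
  ultimately have "(\<Sum>col\<in>Cs. 3 ^ (c + 2) * card {e\<in>A. good col e}) < (\<Sum>col\<in>Cs. card A)"
    using finC by (intro sum_strict_mono) auto
  also have "\<dots> = 3 ^ card V * card A" by (simp add: cardC)
  finally have 1: "(\<Sum>col\<in>Cs. 3 ^ (c + 2) * card {e\<in>A. good col e}) < 3 ^ card V * card A" .
  have "(\<Sum>col\<in>Cs. card {e\<in>A. good col e}) = (\<Sum>col\<in>Cs. \<Sum>e\<in>A. if good col e then 1 else 0)"
    by (simp only: card_eq_sum sum.inter_filter[OF assms(2)])
  also have "\<dots> = (\<Sum>e\<in>A. \<Sum>col\<in>Cs. if good col e then 1 else 0)" by (rule sum.swap)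
  also have "\<dots> = (\<Sum>e\<in>A. card {col\<in>Cs. good col e})"
    by (simp only: card_eq_sum sum.inter_filter[OF finC])
  finally have 2: "(\<Sum>col\<in>Cs. card {e\<in>A. good col e}) = (\<Sum>e\<in>A. card {col\<in>Cs. good col e})" .
  have 3: "3 ^ card V \<le> 3 ^ (c + 2) * card {col\<in>Cs. good col e}" if "e \<in> A" for e
  proof -
    obtain u v where e: "e = (u, v)" by force
    have uv: "u \<in> V" "v \<in> V" "u \<noteq> v" "W u v \<subseteq> V" "card (W u v) \<le> c" "u \<notin> W u v" "v \<notin> W u v"
      using W[of u v] that assms(3) by (auto simp: e)
    define S where "S = insert u (insert v (W u v))"
    \<comment> \<open>The colours allowed at each vertex: a single one on \<open>S\<close>, all
      three elsewhere.\<close>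
    define P where "P w = (if w = u then {0} else if w = v then {1} else if w \<in> W u v then {2} else {0, 1, 2 :: nat})" for w
    have "finite (W u v)" using uv(4) assms(1) finite_subset by blast
    then have "card S \<le> c + 2" using uv(5-7) uv(3) by (simp add: S_def)
    have P: "card (P w) = (if w \<in> V - S then 3 else 1)" if "w \<in> V" for w
      using that by (auto simp: P_def S_def)
    have "Pi\<^sub>E V P \<subseteq> {col\<in>Cs. good col e}"
    proof
      fix col assume col: "col \<in> Pi\<^sub>E V P"
      have "Pi\<^sub>E V P \<subseteq> Cs" unfolding Cs_def by (rule PiE_mono) (auto simp: P_def)
      with col have "col \<in> Cs" by blast
      moreover have "col u = 0" using PiE_mem[OF col uv(1)] by (simp add: P_def)
      moreover have "col v = 1" using PiE_mem[OF col uv(2)] uv(3) by (simp add: P_def)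
      moreover have "col w = 2" if "w \<in> W u v" for w
      proof -
        have "w \<in> V" "w \<noteq> u" "w \<noteq> v" using that uv(4,6,7) by auto
        then show ?thesis using PiE_mem[OF col \<open>w \<in> V\<close>] that by (simp add: P_def)
      qed
      ultimately show "col \<in> {col\<in>Cs. good col e}" by (simp add: good_def e)
    qed
    then have "card (Pi\<^sub>E V P) \<le> card {col\<in>Cs. good col e}" using finC by (intro card_mono) auto
    moreover have "card (Pi\<^sub>E V P) = 3 ^ card (V - S)"
    proof -
      have "card (Pi\<^sub>E V P) = (\<Prod>w\<in>V. if w \<in> V - S then 3 else 1)"
        using assms(1) P by (simp add: card_PiE)
      also have "\<dots> = (\<Prod>w\<in>V - S. 3)" using assms(1) by (intro prod.mono_neutral_cong_right) auto
      finally show ?thesis by simp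
    qed
    moreover have "card V \<le> c + 2 + card (V - S)"
      using \<open>card S \<le> c + 2\<close> assms(1) diff_card_le_card_Diff[of S V] \<open>finite (W u v)\<close> by (simp add: S_def)
    then have "(3 :: nat) ^ card V \<le> 3 ^ (c + 2) * 3 ^ card (V - S)"
      unfolding power_add[symmetric] by (intro power_increasing) auto
    ultimately show ?thesis by (metis mult_le_mono2 le_trans)
  qed
  have "3 ^ card V * card A = (\<Sum>e\<in>A. 3 ^ card V)" by simp
  also have "\<dots> \<le> (\<Sum>e\<in>A. 3 ^ (c + 2) * card {col\<in>Cs. good col e})" by (rule sum_mono) (rule 3)
  also have "\<dots> = (\<Sum>col\<in>Cs. 3 ^ (c + 2) * card {e\<in>A. good col e})"
    unfolding sum_distrib_left[symmetric] 2 ..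
  finally show False using 1 by simp
qed

text \<open>By the choice of the colouring, a path of length \<open>2 l - 1\<close> between the ends of a kept edge
  cannot consist of kept edges, since it meets the set \<open>W\<close> of that edge. So the kept edges
  contain no cycle of length \<open>2 l\<close>.\<close>

lemma admissible_card_edges_le:
  fixes H :: "'a ugraph"
  assumes H: "fin_simple_graph H" "st_admissible H (theta_graph s (2 * l - 1))" and "l \<ge> 2" "s \<ge> 1"
    and t: "t \<ge> 1" "card (uverts H) < t ^ l"
  shows "card (uedges H) \<le> 3 ^ (s * (2 * l - 1) + 2) * ((2 * l + 2) ^ l * (t + 3) * card (uverts H))"
proof -
  define k where "k = 2 * l - 1"
  have k: "k \<ge> 2" "2 * l = Suc k" using \<open>l \<ge> 2\<close> by (auto simp: k_def)
  define V where "V = uverts H"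
  have finV: "finite V" using H(1) by (simp add: V_def fin_simple_graph_def)
  have edge: "e \<subseteq> V \<and> card e = 2" if "e \<in> uedges H" for e
    using that H(1) by (auto simp: V_def fin_simple_graph_def)
  \<comment> \<open>Both orientations of every edge, each with its own blocking set.\<close>
  define A where "A = {(u, v). {u, v} \<in> uedges H}"
  have A: "A \<subseteq> V \<times> V" using edge by (auto simp: A_def)
  have finA: "finite A" using A finV by (meson finite_SigmaI finite_subset)
  have "\<exists>W. \<forall>u v. (u, v) \<in> A \<longrightarrow> W u v \<subseteq> V \<and> card (W u v) \<le> s * k \<and> u \<notin> W u v \<and> v \<notin> W u v \<and>
    (\<forall>x. inj_on x {..k} \<and> x 0 = u \<and> x k = v \<and> (\<forall>i<k. {x i, x (Suc i)} \<in> uedges H) \<longrightarrow> (\<exists>i\<in>{0<..<k}. x i \<in> W u v))"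
    unfolding A_def V_def using admissible_path_blocker[OF H(1) H(2)[folded k_def] k(1) \<open>s \<ge> 1\<close>]
    by (intro choice allI) auto
  then obtain W where W: "\<And>u v. (u, v) \<in> A \<Longrightarrow> W u v \<subseteq> V \<and> card (W u v) \<le> s * k \<and> u \<notin> W u v \<and> v \<notin> W u v"
    and blocks: "\<And>u v x. (u, v) \<in> A \<Longrightarrow> inj_on x {..k} \<Longrightarrow> x 0 = u \<Longrightarrow> x k = v \<Longrightarrow>
      (\<And>i. i < k \<Longrightarrow> {x i, x (Suc i)} \<in> uedges H) \<Longrightarrow> \<exists>i\<in>{0<..<k}. x i \<in> W u v"
    by metis
  have "u \<noteq> v" if "(u, v) \<in> A" for u v using edge[of "{u, v}"] that by (auto simp: A_def)
  with W have "\<exists>col :: 'a \<Rightarrow> nat. card A \<le> 3 ^ (s * k + 2) *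
    card {(u, v) \<in> A. col u = 0 \<and> col v = 1 \<and> (\<forall>w\<in>W u v. col w = 2)}"
    by (intro ex_three_colouring[OF finV finA A]) auto
  then obtain col :: "'a \<Rightarrow> nat" where col: "card A \<le> 3 ^ (s * k + 2) *
    card {(u, v) \<in> A. col u = 0 \<and> col v = 1 \<and> (\<forall>w\<in>W u v. col w = 2)}" by blast
  define B where "B = {(u, v) \<in> A. col u = 0 \<and> col v = 1 \<and> (\<forall>w\<in>W u v. col w = 2)}"
  define U0 U1 where "U0 = {v\<in>V. col v = 0}" and "U1 = {v\<in>V. col v = 1}"
  have fin: "finite U0" "finite U1" and disj: "U0 \<inter> U1 = {}" using finV by (auto simp: U0_def U1_def)
  have B: "B \<subseteq> U0 \<times> U1" using A by (auto simp: B_def U0_def U1_def)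
  define adj where "adj x y \<longleftrightarrow> (x, y) \<in> B \<or> (y, x) \<in> B" for x y
  have adj_H: "{x, y} \<in> uedges H" if "adj x y" for x y
    using that by (auto simp: adj_def B_def A_def insert_commute)
  have adj_col: "col x \<noteq> 2" if "adj x y" for x y
    using that by (auto simp: adj_def B_def)
  \<comment> \<open>An inner vertex in the blocking set has colour 2, whereas the edges in
    \<open>B\<close> only join colours 0 and 1.\<close>
  have blocked: False if uv: "(x 0, x k) \<in> B" and x: "inj_on x {..k}" "\<And>i. i < k \<Longrightarrow> adj (x i) (x (Suc i))" for x
  proof -
    obtain i where i: "i < k" "x i \<in> W (x 0) (x k)"
      using blocks[OF _ x(1) refl refl adj_H[OF x(2)]] uv by (auto simp: B_def)
    then have "col (x i) = 2" using uv by (auto simp: B_def)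
    then show False using adj_col[OF x(2)[OF i(1)]] by simp
  qed
  have "\<not> has_cycle adj (2 * l)"
  proof
    assume "has_cycle adj (2 * l)"
    then obtain x where "inj_on x {..<Suc k}" and cyc: "\<And>i. i < Suc k \<Longrightarrow> adj (x i) (x (Suc i mod Suc k))"
      unfolding has_cycle_def k(2) by blast
    have inj: "inj_on x {..k}"
      using \<open>inj_on x {..<Suc k}\<close> by (simp add: lessThan_Suc_atMost)
    have x: "adj (x i) (x (Suc i))" if "i < k" for i using cyc[of i] that by simp
    have "adj (x k) (x 0)" using cyc[of k] by simp
    then consider "(x 0, x k) \<in> B" | "(x k, x 0) \<in> B" by (auto simp: adj_def)
    then show False
    proof cases
      case 1
      then show False using blocked[OF _ inj x] by blast
    next
      case 2
      \<comment> \<open>The closing edge is oriented from \<open>x k\<close> to \<open>x 0\<close>,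
        so the path is read backwards.\<close>
      define y where "y i = x (k - i)" for i
      have "inj_on y {..k}"
      proof (rule inj_onI)
        fix i j assume "i \<in> {..k}" "j \<in> {..k}" "y i = y j"
        then have "k - i = k - j" using inj_onD[OF inj, of "k - i" "k - j"] by (simp add: y_def)
        then show "i = j" using \<open>i \<in> {..k}\<close> \<open>j \<in> {..k}\<close> by simp
      qed
      moreover have "adj (y i) (y (Suc i))" if "i < k" for i
        using x[of "k - Suc i"] that by (auto simp: y_def adj_def Suc_diff_Suc)
      ultimately show False using blocked[of y] 2 by (simp add: y_def)
    qed
  qed
  then have no_cycle: "\<not> has_cycle (\<lambda>x y. (x, y) \<in> B \<or> (y, x) \<in> B) (2 * l)"
    unfolding adj_def .
  have U01: "card U0 + card U1 \<le> card V"
    using card_Un_disjoint[OF fin disj] card_mono[OF finV, of "U0 \<union> U1"] by (auto simp: U0_def U1_def)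
  \<comment> \<open>Otherwise \<open>B\<close> would be dense enough to force
    \<open>t ^ l \<le> card V\<close>.\<close>
  have "card B \<le> (2 * l + 2) ^ l * (t + 3) * (card U0 + card U1)"
    using bipartite_dense_even_cycle[OF fin disj B no_cycle t(1)] U01 t(2) by (force simp: V_def)
  also have "\<dots> \<le> (2 * l + 2) ^ l * (t + 3) * card V"
    using U01 by (intro mult_le_mono2)
  finally have cB: "card B \<le> (2 * l + 2) ^ l * (t + 3) * card V" .
  have "uedges H \<subseteq> (\<lambda>(u, v). {u, v}) ` A"
    using edge by (force simp: A_def card_2_iff)
  then have "card (uedges H) \<le> card A"
    using finA by (meson card_image_le card_mono finite_imageI le_trans)
  also have "\<dots> \<le> 3 ^ (s * k + 2) * card B" using col by (simp add: B_def)
  also have "\<dots> \<le> 3 ^ (s * k + 2) * ((2 * l + 2) ^ l * (t + 3) * card V)"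
    using cB by (intro mult_le_mono2)
  finally show ?thesis by (simp add: V_def k_def)
qed

section \<open>From admissible graphs to \<open>st\<close>\<close>

lemma finite_st_candidates:
  "finite {card (uedges H) | H :: nat ugraph. fin_simple_graph H \<and> card (uverts H) = n \<and> st_admissible H G}"
proof (rule finite_subset[of _ "{..2 ^ n}"])
  have "card (uedges H) \<le> 2 ^ card (uverts H)" if "fin_simple_graph H" for H :: "nat ugraph"
    using that card_mono[of "Pow (uverts H)" "uedges H"] by (auto simp: card_Pow fin_simple_graph_def)
  then show "{card (uedges H) | H :: nat ugraph. fin_simple_graph H \<and> card (uverts H) = n \<and> st_admissible H G} \<subseteq> {..2 ^ n}"
    by auto
qed simp

lemma card_edges_le_st:
  fixes H :: "nat ugraph"
  shows "fin_simple_graph H \<Longrightarrow> st_admissible H G \<Longrightarrow> card (uedges H) \<le> st (card (uverts H)) G"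
  unfolding st_def by (intro Max_ge finite_st_candidates CollectI exI[of _ H]) simp

text \<open>A bound on all candidates bounds their \<open>Max\<close> only if there is one. The
  edgeless graph serves, as it contains no copy of a graph with an edge.\<close>

lemma st_leI:
  assumes "uedges G \<noteq> {}"
    and "\<And>H :: nat ugraph. fin_simple_graph H \<Longrightarrow> card (uverts H) = n \<Longrightarrow> st_admissible H G \<Longrightarrow> card (uedges H) \<le> m"
  shows "st n G \<le> m"
proof -
  define H :: "nat ugraph" where "H = \<lparr>uverts = {..<n}, uedges = {}\<rparr>"
  have "st_admissible H G"
    unfolding st_admissible_def contains_properly_def is_subgraph_def graph_iso_def H_def
    using assms(1) by auto
  moreover have "fin_simple_graph H" "card (uverts H) = n" by (auto simp: H_def fin_simple_graph_def)
  ultimately show ?thesis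
    unfolding st_def using assms(2) by (subst Max_le_iff[OF finite_st_candidates]) blast+
qed

lemma st_theta_upper:
  assumes "l \<ge> 2" "s \<ge> 1"
  shows "(\<lambda>n. real (st n (theta_graph s (2 * l - 1)))) \<in> O(\<lambda>n. real n powr (1 + 1 / real l))"
proof -
  define C where "C = 3 ^ (s * (2 * l - 1) + 2) * (2 * l + 2) ^ l"
  have "norm (real (st n (theta_graph s (2 * l - 1)))) \<le> 5 * real C * norm (real n powr (1 + 1 / real l))" if "n \<ge> 1" for n
  proof -
    define r where "r = real n powr (1 / real l)"
    have "r \<ge> 1" using that by (simp add: r_def ge_one_powr_ge_zero)
    \<comment> \<open>The least integer above the \<open>l\<close>-th root \<open>r\<close> of
      \<open>n\<close>, so that \<open>n < t ^ l\<close>. As \<open>r \<ge> 1\<close>, also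
      \<open>t + 3 \<le> r + 4 \<le> 5 * r\<close>, which explains the constant 5.\<close>
    define t where "t = nat \<lfloor>r\<rfloor> + 1"
    have t: "r < real t" "real t \<le> r + 1" using \<open>r \<ge> 1\<close> unfolding t_def by linarith+
    have "real n = r ^ l" using that assms(1) by (simp add: r_def powr_realpow[symmetric] powr_powr)
    also have "\<dots> < real t ^ l" using t(1) \<open>r \<ge> 1\<close> assms(1) by (intro power_strict_mono) auto
    finally have nt: "n < t ^ l" by (simp flip: of_nat_power)
    have "st n (theta_graph s (2 * l - 1)) \<le> C * ((t + 3) * n)"
    proof (rule st_leI)
      show "uedges (theta_graph s (2 * l - 1)) \<noteq> {}" using assms by (auto simp: theta_edges lessThan_empty_iff)
    qed (use admissible_card_edges_le[of _ s l t] assms nt in \<open>auto simp: C_def t_def mult.assoc\<close>)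
    then have "real (st n (theta_graph s (2 * l - 1))) \<le> real (C * ((t + 3) * n))"
      by (rule of_nat_mono)
    also have "\<dots> = real C * ((real t + 3) * real n)" by simp
    also have "\<dots> \<le> real C * ((5 * r) * real n)"
      using t(2) \<open>r \<ge> 1\<close> by (intro mult_left_mono mult_right_mono) auto
    also have "r * real n = real n powr (1 + 1 / real l)"
      using that by (simp add: r_def powr_add)
    then have "real C * ((5 * r) * real n) = 5 * real C * real n powr (1 + 1 / real l)" by simp
    finally show ?thesis by simp
  qed
  then show ?thesis
    by (intro bigoI[of _ "5 * real C"] eventually_sequentiallyI[of 1])
qed

section \<open>The lower bound\<close>

text \<open>Two vertices lie on a common cycle of length \<open>2 * k\<close> made of two of the
  paths, and the shorter of its arcs between them has at most \<open>k\<close> edges.\<close>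

lemma theta_connecting_path:
  assumes "s \<ge> 2" "k \<ge> 1" and ab: "a \<in> uverts (theta_graph s k)" "b \<in> uverts (theta_graph s k)" "a \<noteq> b"
  shows "\<exists>d y. d \<le> k \<and> inj_on y {..d} \<and> {y 0, y d} = {a, b} \<and>
    (\<forall>i<d. {y i, y (Suc i)} \<in> uedges (theta_graph s k))"
proof -
  obtain i j i\<^sub>1 j' where a: "a = theta_path k i j" "i < s" "j \<le> k" and b: "b = theta_path k i\<^sub>1 j'" "i\<^sub>1 < s" "j' \<le> k"
    using ab by (auto simp: theta_verts)
  \<comment> \<open>The path of \<open>b\<close> if it differs from that of \<open>a\<close>, and
    otherwise any other path; \<open>s \<ge> 2\<close> provides one.\<close>
  define i' where "i' = (if i\<^sub>1 \<noteq> i then i\<^sub>1 else if i = 0 then 1 else 0)"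
  have i': "i' < s" "i' \<noteq> i" using b(2) assms(1) by (auto simp: i'_def)
  define n where "n = 2 * k"
  \<comment> \<open>Walks round the cycle with period \<open>n\<close>, up along path
    \<open>i\<close> and back down along path \<open>i'\<close>. Periodicity lets an arc run past
    the starting point.\<close>
  define g where "g r = (if r mod n \<le> k then theta_path k i (r mod n) else theta_path k i' (n - r mod n))" for r
  have n: "n > 0" "k < n" using assms(2) by (auto simp: n_def)
  have g_mod: "g (r mod n) = g r" for r by (simp add: g_def)
  have g_inj: "r = r'" if "g r = g r'" "r < n" "r' < n" for r r'
    using that i'(2) assms(2) by (auto simp: g_def theta_path_def n_def split: if_splits)
  have g_step: "{g r, g (Suc r)} \<in> uedges (theta_graph s k)" for r
  proof -
    have edge: "{theta_path k p q, theta_path k p (Suc q)} \<in> uedges (theta_graph s k)" if "p < s" "q < k" for p q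
      using that by (auto simp: theta_edges)
    define m where "m = r mod n"
    have "m < n" using n(1) by (simp add: m_def)
    have Suc_mod: "Suc r mod n = (if Suc m = n then 0 else Suc m)" by (simp add: m_def mod_Suc)
    have gr: "g r = (if m \<le> k then theta_path k i m else theta_path k i' (n - m))"
      by (simp add: g_def m_def)
    have gSr: "g (Suc r) = (if Suc m = n then theta_path k i 0
      else if Suc m \<le> k then theta_path k i (Suc m) else theta_path k i' (n - Suc m))"
      by (simp add: g_def Suc_mod)
    show ?thesis
    proof (cases "m < k")
      case True
      then have "g r = theta_path k i m" "g (Suc r) = theta_path k i (Suc m)"
        using gr gSr n(2) by auto
      then show ?thesis using edge[OF a(2) True] by simp
    next
      case False
      have "g r = theta_path k i' (Suc (n - Suc m))"
        using False \<open>m < n\<close> gr by (auto simp: theta_path_def n_def)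
      moreover have "g (Suc r) = theta_path k i' (n - Suc m)"
        using False \<open>m < n\<close> gSr by (auto simp: theta_path_def n_def)
      moreover have "n - Suc m < k" using False \<open>m < n\<close> by (simp add: n_def)
      ultimately show ?thesis using edge[OF i'(1)] by (simp add: insert_commute)
    qed
  qed
  have "\<exists>p<n. g p = a"
    using a n by (intro exI[of _ j]) (auto simp: g_def)
  then obtain p where p: "p < n" "g p = a" by blast
  have "\<exists>q<n. g q = b"
  proof (cases "i\<^sub>1 = i")
    case True
    then show ?thesis using b n by (intro exI[of _ j']) (auto simp: g_def)
  next
    case False
    then have "i' = i\<^sub>1" by (simp add: i'_def)
    have "g ((n - j') mod n) = b"
      using b n assms(2) \<open>i' = i\<^sub>1\<close> unfolding g_mod
      by (cases "j' = 0") (auto simp: g_def theta_path_def n_def)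
    then show ?thesis using n(1) mod_less_divisor by blast
  qed
  then obtain q where q: "q < n" "g q = b" by blast
  have "p \<noteq> q" using p q ab(3) by auto
  define P Q where "P = min p q" and "Q = max p q"
  have PQ: "P < Q" "Q < n" "{g P, g Q} = {a, b}"
    using p q \<open>p \<noteq> q\<close> by (auto simp: P_def Q_def min_def max_def)
  have inj: "inj_on (\<lambda>i. g (r + i)) {..d}" if "d < n" for r d
  proof (rule linorder_inj_onI)
    fix i j assume ij: "i < j" "i \<in> {..d}" "j \<in> {..d}"
    show "g (r + i) \<noteq> g (r + j)"
    proof
      assume "g (r + i) = g (r + j)"
      then have "(r + i) mod n = (r + j) mod n" using g_inj[of "(r + i) mod n" "(r + j) mod n"] n(1) by (simp add: g_mod)
      then have "n dvd (r + j) - (r + i)" using ij(1) by (metis mod_eq_dvd_iff_nat add_le_cancel_left less_imp_le)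
      then show False using ij that by (auto dest: dvd_imp_le)
    qed
  qed auto
  have "\<exists>d r. d \<le> k \<and> {g r, g (r + d)} = {a, b}"
  proof (cases "Q - P \<le> k")
    case True
    then show ?thesis using PQ by (intro exI[of _ "Q - P"] exI[of _ P]) simp
  next
    case False
    have "g (n + P) = g P" using g_mod[of "n + P"] g_mod[of P] by simp
    moreover have "Q + (n - (Q - P)) = n + P" using PQ by simp
    ultimately have "{g Q, g (Q + (n - (Q - P)))} = {a, b}"
      using PQ(3) by (metis insert_commute)
    moreover have "n - (Q - P) \<le> k" using False by (simp add: n_def)
    ultimately show ?thesis by blast
  qed
  then obtain d r where d: "d \<le> k" "{g r, g (r + d)} = {a, b}" by blast
  define y where "y = (\<lambda>i. g (r + i))"
  have "inj_on y {..d}" using inj[of d r] d(1) n(2) by (simp add: y_def)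
  moreover have "{y 0, y d} = {a, b}" using d(2) by (simp add: y_def)
  moreover have "{y i, y (Suc i)} \<in> uedges (theta_graph s k)" for i using g_step[of "r + i"] by (simp add: y_def)
  ultimately show ?thesis using d(1) by blast
qed

text \<open>A proper supergraph of a copy on equally many vertices has the same vertex set, hence an
  additional edge. A path of length \<open>d \<le> 2 * l - 1\<close> in the copy joins its ends;
  \<open>d\<close> is odd by the 2-colouring \<open>c\<close>, and \<open>d\<close> is not 1 since
  the edge is not in the copy. So the edge closes a cycle of even length from 4 to
  \<open>2 * l\<close>.\<close>

lemma admissible_if_no_short_even_cycle:
  fixes H :: "'a ugraph"
  assumes H: "fin_simple_graph H" and bip: "\<And>x y. {x, y} \<in> uedges H \<Longrightarrow> c x \<longleftrightarrow> \<not> c y"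
    and no_cycle: "\<And>t. 2 \<le> t \<Longrightarrow> t \<le> l \<Longrightarrow> \<not> has_cycle (\<lambda>x y. {x, y} \<in> uedges H) (2 * t)"
    and "s \<ge> 2" "l \<ge> 1"
  shows "st_admissible H (theta_graph s (2 * l - 1))"
  unfolding st_admissible_def contains_properly_def
proof (intro allI impI notI)
  define T where "T = theta_graph s (2 * l - 1)"
  fix F assume "is_subgraph F H \<and> card (uverts F) = card (uverts (theta_graph s (2 * l - 1)))"
    and "\<exists>G'. is_subgraph G' F \<and> G' \<noteq> F \<and> graph_iso (theta_graph s (2 * l - 1)) G'"
  then obtain G f where F: "is_subgraph F H" "card (uverts F) = card (uverts T)"
    and G: "is_subgraph G F" "G \<noteq> F" and f: "bij_betw f (uverts T) (uverts G)" "uedges G = (\<lambda>e. f ` e) ` uedges T"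
    by (auto simp: T_def graph_iso_def)
  have "uverts G \<subseteq> uverts F" "finite (uverts F)" using G(1) by (auto simp: is_subgraph_def fin_simple_graph_def)
  moreover have "card (uverts G) = card (uverts F)" using bij_betw_same_card[OF f(1)] F(2) by simp
  ultimately have verts: "uverts G = uverts F" by (metis card_subset_eq)
  then have "uedges G \<noteq> uedges F" using G(2) by (metis ugraph.equality unit.exhaust)
  then obtain e where e: "e \<in> uedges F" "e \<notin> uedges G" using G(1) by (auto simp: is_subgraph_def)
  then have "card e = 2" "e \<subseteq> uverts G" using F(1) verts by (auto simp: is_subgraph_def fin_simple_graph_def)
  then obtain a' b' where "a' \<noteq> b'" "e = {a', b'}" "a' \<in> f ` uverts T" "b' \<in> f ` uverts T"
    using f(1) by (auto simp: card_2_iff bij_betw_def)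
  then obtain a b where ab: "f a \<noteq> f b" "e = {f a, f b}" "a \<in> uverts T" "b \<in> uverts T" by blast
  have "a \<noteq> b" "2 * l - 1 \<ge> 1" using ab(1) assms(5) by auto
  from theta_connecting_path[OF assms(4) this(2) ab(3,4)[unfolded T_def] this(1)]
  obtain d y where y: "d \<le> 2 * l - 1" "inj_on y {..d}" "{y 0, y d} = {a, b}"
    "\<forall>i<d. {y i, y (Suc i)} \<in> uedges T"
    unfolding T_def by blast
  define x where "x i = f (y i)" for i
  have x_adj: "{x i, x (Suc i)} \<in> uedges G" if "i < d" for i
    using y(4) that unfolding f(2) x_def by (metis image_empty image_eqI image_insert)
  have GH: "uedges G \<subseteq> uedges H" using F(1) G(1) by (auto simp: is_subgraph_def)
  have "{x 0, x d} = f ` {y 0, y d}" by (simp add: x_def)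
  then have x0d: "{x 0, x d} = e" unfolding y(3) using ab(2) by simp
  have parity: "c (x i) \<longleftrightarrow> (c (x 0) \<longleftrightarrow> even i)" if "i \<le> d" for i
    using that
  proof (induction i)
    case (Suc i)
    then have "c (x i) \<longleftrightarrow> \<not> c (x (Suc i))" using x_adj[of i] GH by (intro bip) auto
    then show ?case using Suc by auto
  qed simp
  have eH: "{x 0, x d} \<in> uedges H" using e(1) F(1) x0d by (auto simp: is_subgraph_def)
  then have "odd d" using bip[of "x 0" "x d"] parity[of d] by auto
  moreover have "d \<noteq> 1"
  proof
    assume "d = 1"
    then show False using x_adj[of 0] x0d e(2) by simp
  qed
  ultimately have "odd d" "d \<ge> 3" by (auto elim!: oddE)
  define t where "t = Suc d div 2"
  have t: "Suc d = 2 * t" using \<open>odd d\<close> by (simp add: t_def)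
  then have "2 \<le> t" "t \<le> l" using \<open>d \<ge> 3\<close> y(1) assms(5) by auto
  have yT: "y i \<in> uverts T" if "i \<le> d" for i
  proof (cases "i = d")
    case True
    then show ?thesis using y(3) ab(3,4) by auto
  next
    case False
    then have "{y i, y (Suc i)} \<in> uedges T" using y(4) that by simp
    then obtain p q where pq: "p < s" "q < 2 * l - 1"
      "{y i, y (Suc i)} = {theta_path (2 * l - 1) p q, theta_path (2 * l - 1) p (Suc q)}"
      by (auto simp: T_def theta_edges)
    then have "y i \<in> {theta_path (2 * l - 1) p q, theta_path (2 * l - 1) p (Suc q)}" by blast
    moreover have "theta_path (2 * l - 1) p q' \<in> uverts T" if "q' \<le> 2 * l - 1" for q'
      unfolding T_def theta_verts using pq(1) that by (intro image_eqI[of _ _ "(p, q')"]) auto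
    ultimately show ?thesis using pq(2) by auto
  qed
  have "inj_on x {..d}"
    using y(2) f(1) yT unfolding x_def by (auto simp: inj_on_def bij_betw_def)
  moreover have "{x i, x (Suc i mod Suc d)} \<in> uedges H" if "i < Suc d" for i
    using that x_adj[of i] GH eH by (cases "i = d") (auto simp: insert_commute)
  ultimately have "has_cycle (\<lambda>x y. {x, y} \<in> uedges H) (Suc d)"
    unfolding has_cycle_def by (intro exI[of _ x]) (simp add: lessThan_Suc_atMost)
  then show False using no_cycle[OF \<open>2 \<le> t\<close> \<open>t \<le> l\<close>] t by simp
qed

section \<open>Incidence graphs without short cycles\<close>

text \<open>The order matters: the first one, two and four monomials give the affine parts of a
  projective plane, a generalised quadrangle and a generalised hexagon, for
  \<open>l = 2, 3, 5\<close>.\<close>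

definition hexagon_form :: "nat \<Rightarrow> 'a::comm_ring_1 \<Rightarrow> 'a \<Rightarrow> 'a" where
  "hexagon_form j x y = (if j = 0 then y * x else if j = 1 then y * x^2 else if j = 2 then y * x^3 else y^2 * x^3)"

lemma sum_lessThan_numeral:
  "sum f {..<numeral k} = sum f {..<pred_numeral k} + f (pred_numeral k)"
  by (simp add: numeral_eq_Suc)

text \<open>The cases of cycles of length 4, 6, 8 and 10. Length 8 has to be excluded only for
  \<open>l = 5\<close>, where all four monomials are available.\<close>

lemma no_closed_sequence:
  fixes a b :: "nat \<Rightarrow> 'a::field"
  assumes char: "(3 :: 'a) = 0"
    and e: "\<And>j. j < m \<Longrightarrow> (\<Sum>i<t. hexagon_form j (a i) (b i) - hexagon_form j (a (Suc i mod t)) (b i)) = 0"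
    and a: "\<And>i. i < t \<Longrightarrow> a i \<noteq> a (Suc i mod t)" and b: "\<And>i. i < t \<Longrightarrow> b i \<noteq> b (Suc i mod t)"
    and t: "t = 2 \<and> m \<ge> 1 \<or> t = 3 \<and> m \<ge> 2 \<or> t \<in> {4, 5} \<and> m \<ge> 4"
  shows False
proof -
  consider "t = 2" "m \<ge> 1" | "t = 3" "m \<ge> 2" | "t = 4" "m \<ge> 4" | "t = 5" "m \<ge> 4" using t by auto
  then show False
  proof cases
    case 1
    have "b 0 * (a 0 - a 1) + b 1 * (a 1 - a 0) = 0"
      using e[of 0] 1 by (simp add: sum_lessThan_numeral hexagon_form_def algebra_simps flip: numeral_2_eq_2)
    then show False using no_closed_pair[of "b 0" "a 0" "a 1" "b 1"] a[of 0] b[of 0] 1 by auto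
  next
    case 2
    have "b 0 * (a 0 - a 1) + b 1 * (a 1 - a 2) + b 2 * (a 2 - a 0) = 0"
      using e[of 0] 2 by (simp add: sum_lessThan_numeral hexagon_form_def algebra_simps flip: numeral_2_eq_2)
    moreover have "b 0 * (a 0^2 - a 1^2) + b 1 * (a 1^2 - a 2^2) + b 2 * (a 2^2 - a 0^2) = 0"
      using e[of 1] 2 by (simp add: sum_lessThan_numeral hexagon_form_def algebra_simps flip: numeral_2_eq_2)
    ultimately show False using no_closed_triple[of "b 0" "a 0" "a 1" "b 1" "a 2" "b 2"] a[of 0] a[of 2] b[of 2] 2 by auto
  next
    case 3
    note S = sum_lessThan_numeral hexagon_form_def algebra_simps
    have "b 0 * (a 0 - a 1) + b 1 * (a 1 - a 2) + b 2 * (a 2 - a 3) + b 3 * (a 3 - a 0) = 0"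
      "b 0 * (a 0^2 - a 1^2) + b 1 * (a 1^2 - a 2^2) + b 2 * (a 2^2 - a 3^2) + b 3 * (a 3^2 - a 0^2) = 0"
      "b 0 * (a 0^3 - a 1^3) + b 1 * (a 1^3 - a 2^3) + b 2 * (a 2^3 - a 3^3) + b 3 * (a 3^3 - a 0^3) = 0"
      "b 0^2 * (a 0^3 - a 1^3) + b 1^2 * (a 1^3 - a 2^3) + b 2^2 * (a 2^3 - a 3^3) + b 3^2 * (a 3^3 - a 0^3) = 0"
      using e[of 0] e[of 1] e[of 2] e[of 3] 3 by (simp_all add: S flip: numeral_2_eq_2)
    then show False
      by (rule no_closed_quadruple[OF char]) (use a[of 0] a[of 1] a[of 2] a[of 3] b[of 0] b[of 1] b[of 2] b[of 3] 3 in \<open>simp_all flip: numeral_2_eq_2\<close>)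
  next
    case 4
    note S = sum_lessThan_numeral hexagon_form_def algebra_simps
    have "b 0 * (a 0 - a 1) + b 1 * (a 1 - a 2) + b 2 * (a 2 - a 3) + b 3 * (a 3 - a 4) + b 4 * (a 4 - a 0) = 0"
      "b 0 * (a 0^2 - a 1^2) + b 1 * (a 1^2 - a 2^2) + b 2 * (a 2^2 - a 3^2) + b 3 * (a 3^2 - a 4^2) + b 4 * (a 4^2 - a 0^2) = 0"
      "b 0 * (a 0^3 - a 1^3) + b 1 * (a 1^3 - a 2^3) + b 2 * (a 2^3 - a 3^3) + b 3 * (a 3^3 - a 4^3) + b 4 * (a 4^3 - a 0^3) = 0"
      "b 0^2 * (a 0^3 - a 1^3) + b 1^2 * (a 1^3 - a 2^3) + b 2^2 * (a 2^3 - a 3^3) + b 3^2 * (a 3^3 - a 4^3) + b 4^2 * (a 4^3 - a 0^3) = 0"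
      using e[of 0] e[of 1] e[of 2] e[of 3] 4 by (simp_all add: S flip: numeral_2_eq_2)
    then show False
      by (rule no_closed_quintuple[OF char]) (use a[of 0] a[of 1] a[of 2] a[of 3] a[of 4] b[of 0] b[of 1] b[of 2] b[of 3] b[of 4] 4 in \<open>simp_all flip: numeral_2_eq_2\<close>)
  qed
qed

type_synonym 'a vertex = "bool \<times> 'a \<times> (nat \<Rightarrow> 'a)"

text \<open>The first component tells points (\<open>True\<close>) from lines.\<close>

definition hexagon_verts :: "'a set \<Rightarrow> nat \<Rightarrow> 'a vertex set" where
  "hexagon_verts K m = UNIV \<times> K \<times> ({..<m} \<rightarrow>\<^sub>E K)"

definition incident :: "nat \<Rightarrow> 'a::comm_ring_1 vertex \<Rightarrow> 'a vertex \<Rightarrow> bool" where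
  "incident m P L \<longleftrightarrow> fst P \<and> \<not> fst L \<and>
    (\<forall>j<m. snd (snd P) j + snd (snd L) j = hexagon_form j (fst (snd P)) (fst (snd L)))"

definition hexagon_adj :: "'a::comm_ring_1 set \<Rightarrow> nat \<Rightarrow> 'a vertex \<Rightarrow> 'a vertex \<Rightarrow> bool" where
  "hexagon_adj K m x y \<longleftrightarrow> x \<in> hexagon_verts K m \<and> y \<in> hexagon_verts K m \<and> (incident m x y \<or> incident m y x)"

lemma hexagon_verts_eqI:
  assumes "x \<in> hexagon_verts K m" "y \<in> hexagon_verts K m" "fst x = fst y" "fst (snd x) = fst (snd y)"
    and "\<And>j. j < m \<Longrightarrow> snd (snd x) j = snd (snd y) j"
  shows "x = y"
proof -
  have "snd (snd x) = snd (snd y)"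
    using assms(1,2,5) by (intro PiE_ext[of _ "{..<m}" "\<lambda>_. K"]) (auto simp: hexagon_verts_def)
  with assms(3,4) show ?thesis by (simp add: prod_eq_iff)
qed

text \<open>Shifting a cycle of a bipartite graph by one position moves its start to the other
  side.\<close>

lemma has_cycle_rotate:
  assumes "has_cycle adj n" "n \<ge> 1" and flip: "\<And>x y. adj x y \<Longrightarrow> P x \<noteq> P y"
  shows "\<exists>x. inj_on x {..<n} \<and> (\<forall>i<n. adj (x i) (x (Suc i mod n))) \<and> P (x 0)"
proof -
  obtain x where x: "inj_on x {..<n}" "\<forall>i<n. adj (x i) (x (Suc i mod n))"
    using assms(1) unfolding has_cycle_def by blast
  show ?thesis
  proof (cases "P (x 0)")
    case True
    then show ?thesis using x by blast
  next
    case False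
    define y where "y i = x (Suc i mod n)" for i
    have "inj_on y {..<n}"
    proof (rule inj_onI)
      fix i j assume ij: "i \<in> {..<n}" "j \<in> {..<n}" "y i = y j"
      then have "Suc i mod n = Suc j mod n"
        using x(1) assms(2) unfolding y_def by (auto dest!: inj_onD)
      then show "i = j" using ij by (auto simp: mod_Suc split: if_splits)
    qed
    moreover have "adj (y i) (y (Suc i mod n))" if "i < n" for i
    proof -
      have "adj (x (Suc i mod n)) (x (Suc (Suc i mod n) mod n))" using x(2) that by simp
      then show ?thesis by (simp add: y_def mod_Suc_eq)
    qed
    moreover have "P (y 0)"
    proof -
      have "adj (x 0) (x (Suc 0 mod n))" using x(2) assms(2) by auto
      from flip[OF this] show ?thesis using False by (simp add: y_def)
    qed
    ultimately show ?thesis by blast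
  qed
qed

text \<open>Let the cycle start at a point, so that points and lines alternate. Subtracting the
  equations of the two points on each line removes the coordinates of the line, and summing round
  the cycle removes those of the points. Consecutive \<open>a i\<close> differ, because points on a
  common line with equal first coordinate agree in all coordinates; likewise for the
  \<open>b i\<close>.\<close>

lemma hexagon_no_cycle:
  fixes K :: "'a::field set"
  assumes char: "(3 :: 'a) = 0" and t: "t = 2 \<and> m \<ge> 1 \<or> t = 3 \<and> m \<ge> 2 \<or> t \<in> {4, 5} \<and> m \<ge> 4"
  shows "\<not> has_cycle (hexagon_adj K m) (2 * t)"
proof
  assume "has_cycle (hexagon_adj K m) (2 * t)"
  moreover have "t \<ge> 2" using t by auto
  moreover have flip: "fst x \<noteq> fst y" if "hexagon_adj K m x y" for x y
    using that by (auto simp: hexagon_adj_def incident_def)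
  ultimately obtain x where x: "inj_on x {..<2 * t}" "\<And>i. i < 2 * t \<Longrightarrow> hexagon_adj K m (x i) (x (Suc i mod (2 * t)))" "fst (x 0)"
    using has_cycle_rotate[of "hexagon_adj K m" "2 * t" fst] \<open>t \<ge> 2\<close> by auto
  have x_verts: "x i \<in> hexagon_verts K m" if "i < 2 * t" for i
    using x(2)[OF that] by (simp add: hexagon_adj_def)
  have kind: "fst (x i) \<longleftrightarrow> even i" if "i < 2 * t" for i
    using that
  proof (induction i)
    case (Suc i)
    then show ?case using flip[OF x(2)[of i]] by simp
  qed (use x(3) in simp)
  define P L where "P i = x (2 * i)" and "L i = x (Suc (2 * i))" for i
  have PL: "incident m (P i) (L i)" if "i < t" for i
  proof -
    have "hexagon_adj K m (P i) (L i)" using x(2)[of "2 * i"] that by (simp add: P_def L_def)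
    then show ?thesis using kind[of "Suc (2 * i)"] that by (auto simp: hexagon_adj_def incident_def L_def)
  qed
  have PL': "incident m (P (Suc i mod t)) (L i)" if "i < t" for i
  proof -
    have "Suc (Suc (2 * i)) mod (2 * t) = 2 * (Suc i mod t)"
      unfolding mult_mod_right by simp
    then have "hexagon_adj K m (L i) (P (Suc i mod t))" using x(2)[of "Suc (2 * i)"] that by (simp add: P_def L_def)
    then show ?thesis using kind[of "Suc (2 * i)"] that by (auto simp: hexagon_adj_def incident_def L_def)
  qed
  have P_verts: "P i \<in> hexagon_verts K m" and L_verts: "L i \<in> hexagon_verts K m" if "i < t" for i
    using x_verts[of "2 * i"] x_verts[of "Suc (2 * i)"] that by (simp_all add: P_def L_def)
  have neq: "i \<noteq> Suc i mod t" "Suc i mod t < t" if "i < t" for i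
    using that \<open>t \<ge> 2\<close> by (auto simp: mod_Suc)
  define a b where "a i = fst (snd (P i))" and "b i = fst (snd (L i))" for i
  define p q where "p i = snd (snd (P i))" and "q i = snd (snd (L i))" for i
  have e1: "p i j + q i j = hexagon_form j (a i) (b i)" if "i < t" "j < m" for i j
    using PL[OF that(1)] that(2) by (simp add: incident_def a_def b_def p_def q_def)
  have e2: "p (Suc i mod t) j + q i j = hexagon_form j (a (Suc i mod t)) (b i)" if "i < t" "j < m" for i j
    using PL'[OF that(1)] that(2) by (simp add: incident_def a_def b_def p_def q_def)
  have P_neq: "P i \<noteq> P i'" and L_neq: "L i \<noteq> L i'" if "i < t" "i' < t" "i \<noteq> i'" for i i'
    using inj_onD[OF x(1), of "2 * i" "2 * i'"] inj_onD[OF x(1), of "Suc (2 * i)" "Suc (2 * i')"] that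
    by (auto simp: P_def L_def)
  show False
  proof (rule no_closed_sequence[OF char _ _ _ t])
    fix j assume j: "j < m"
    have bij: "bij_betw (\<lambda>i. Suc i mod t) {..<t} {..<t}"
    proof (rule bij_betwI')
      show "(Suc i mod t = Suc i' mod t) = (i = i')" if "i \<in> {..<t}" "i' \<in> {..<t}" for i i'
        using that by (auto simp: mod_Suc split: if_splits)
      show "\<exists>i\<in>{..<t}. i' = Suc i mod t" if "i' \<in> {..<t}" for i'
        using that by (intro bexI[of _ "if i' = 0 then t - 1 else i' - 1"]) auto
    qed (use neq in auto)
    have "(\<Sum>i<t. hexagon_form j (a i) (b i) - hexagon_form j (a (Suc i mod t)) (b i)) = (\<Sum>i<t. p i j - p (Suc i mod t) j)"
      by (rule sum.cong) (simp_all add: j flip: e1 e2)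
    also have "\<dots> = 0"
      using sum.reindex_bij_betw[OF bij, of "\<lambda>i. p i j"] by (simp add: sum_subtractf)
    finally show "(\<Sum>i<t. hexagon_form j (a i) (b i) - hexagon_form j (a (Suc i mod t)) (b i)) = 0" .
  next
    fix i assume i: "i < t"
    let ?i = "Suc i mod t"
    show "a i \<noteq> a ?i"
    proof
      assume a: "a i = a ?i"
      have "P i = P ?i"
      proof (rule hexagon_verts_eqI)
        show "snd (snd (P i)) j = snd (snd (P ?i)) j" if "j < m" for j
          using e1[OF i that] e2[OF i that] a by (simp add: p_def) (metis add_right_cancel)
      qed (use P_verts i neq(2)[OF i] PL[OF i] PL'[OF i] a in \<open>auto simp: a_def incident_def\<close>)
      then show False using P_neq i neq by blast
    qed
    show "b i \<noteq> b ?i"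
    proof
      assume b: "b i = b ?i"
      have "L i = L ?i"
      proof (rule hexagon_verts_eqI)
        show "snd (snd (L i)) j = snd (snd (L ?i)) j" if "j < m" for j
          using e1[OF neq(2)[OF i] that] e2[OF i that] b by (simp add: q_def) (metis add_left_cancel)
      qed (use L_verts i neq(2)[OF i] PL[OF neq(2)[OF i]] PL'[OF i] b in \<open>auto simp: b_def incident_def\<close>)
      then show False using L_neq i neq by blast
    qed
  qed
qed

lemma has_cycle_map:
  assumes "has_cycle adj n" and "\<And>x y. adj x y \<Longrightarrow> x \<in> S \<and> adj' (g x) (g y)" and "inj_on g S"
  shows "has_cycle adj' n"
proof -
  obtain x where x: "inj_on x {..<n}" "\<forall>i<n. adj (x i) (x (Suc i mod n))"
    using assms(1) unfolding has_cycle_def by blast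
  have "x ` {..<n} \<subseteq> S" using x(2) assms(2) by blast
  then have "inj_on (g \<circ> x) {..<n}" using x(1) assms(3) by (meson comp_inj_on inj_on_subset)
  then show ?thesis unfolding has_cycle_def using x(2) assms(2) by (intro exI[of _ "g \<circ> x"]) auto
qed

lemma hexagon_form_closed:
  assumes "\<And>x y. x \<in> K \<Longrightarrow> y \<in> K \<Longrightarrow> x * y \<in> K" "x \<in> K" "y \<in> K"
  shows "hexagon_form j x y \<in> K"
  using assms by (simp add: hexagon_form_def power2_eq_square power3_eq_cube)

section \<open>Counting vertices and edges\<close>

text \<open>The incidence graph over \<open>K\<close> has \<open>2 * card K ^ l\<close> vertices. A
  point and the first coordinate of a line determine the line through that point, which gives
  \<open>card K ^ l * card K\<close> edges.\<close>

lemma card_power_le_st: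
  fixes K :: "'a::field set"
  assumes char: "(3 :: 'a) = 0" and K: "finite K" "\<And>x y. x \<in> K \<Longrightarrow> y \<in> K \<Longrightarrow> x - y \<in> K"
      "\<And>x y. x \<in> K \<Longrightarrow> y \<in> K \<Longrightarrow> x * y \<in> K"
    and l: "l \<in> {2, 3, 5}" and n: "2 * card K ^ l \<le> n" and "s \<ge> 2"
  shows "card K ^ (l + 1) \<le> st n (theta_graph s (2 * l - 1))"
proof -
  define m where "m = l - 1"
  have l_eq: "l = Suc m" using l by (auto simp: m_def)
  define V where "V = hexagon_verts K m"
  have finP: "finite ({..<m} \<rightarrow>\<^sub>E K)" using K(1) by (simp add: finite_PiE)
  have finV: "finite V" using K(1) finP by (simp add: V_def hexagon_verts_def)
  have "card V = 2 * card K ^ l"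
    by (simp add: V_def hexagon_verts_def card_cartesian_product card_PiE l_eq)
  \<comment> \<open>The vertices of the host graph outside the image of \<open>f\<close> stay
    isolated.\<close>
  then obtain f where f: "f ` V \<subseteq> {..<n}" "inj_on f V"
    using card_le_inj[OF finV, of "{..<n}"] n by auto
  define H :: "nat ugraph" where "H = \<lparr>uverts = {..<n}, uedges = {{f x, f y} | x y. hexagon_adj K m x y}\<rparr>"
  have adj_V: "x \<in> V \<and> y \<in> V \<and> fst x \<noteq> fst y" if "hexagon_adj K m x y" for x y
    using that by (auto simp: hexagon_adj_def incident_def V_def)
  have edgeE: "\<exists>x y. u = f x \<and> v = f y \<and> hexagon_adj K m x y" if uv: "{u, v} \<in> uedges H" for u v
  proof -
    obtain x y where xy: "{u, v} = {f x, f y}" "hexagon_adj K m x y"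
      using uv unfolding H_def ugraph.simps by blast
    moreover have "hexagon_adj K m y x" using xy(2) by (auto simp: hexagon_adj_def)
    ultimately show ?thesis unfolding doubleton_eq_iff by blast
  qed
  have H: "fin_simple_graph H"
    unfolding fin_simple_graph_def
  proof (intro conjI ballI)
    fix e assume "e \<in> uedges H"
    then obtain x y where e: "e = {f x, f y}" "hexagon_adj K m x y"
      unfolding H_def ugraph.simps by blast
    then have "f x \<noteq> f y" using adj_V inj_onD[OF f(2)] by metis
    then show "card e = 2" by (simp add: e)
    show "e \<subseteq> uverts H" using adj_V[OF e(2)] f(1) by (auto simp: e H_def)
  qed (simp add: H_def)
  define g where "g = inv_into V f"
  have g: "g (f x) = x" if "x \<in> V" for x using that f(2) by (simp add: g_def)
  have g_adj: "u \<in> f ` V \<and> hexagon_adj K m (g u) (g v)" if "{u, v} \<in> uedges H" for u v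
    using edgeE[OF that] adj_V g by force
  have "st_admissible H (theta_graph s (2 * l - 1))"
  proof (rule admissible_if_no_short_even_cycle[OF H])
    show "fst (g u) \<longleftrightarrow> \<not> fst (g v)" if "{u, v} \<in> uedges H" for u v
      using adj_V g_adj[OF that] by blast
    show "\<not> has_cycle (\<lambda>x y. {x, y} \<in> uedges H) (2 * t)" if "2 \<le> t" "t \<le> l" for t
    proof
      assume "has_cycle (\<lambda>x y. {x, y} \<in> uedges H) (2 * t)"
      then have "has_cycle (hexagon_adj K m) (2 * t)"
        by (rule has_cycle_map[of _ _ "f ` V" _ g]) (use g_adj in \<open>auto simp: g_def inj_on_inv_into\<close>)
      moreover have "t = 2 \<and> m \<ge> 1 \<or> t = 3 \<and> m \<ge> 2 \<or> t \<in> {4, 5} \<and> m \<ge> 4"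
        using l that by (auto simp: m_def)
      ultimately show False using hexagon_no_cycle[OF char] by blast
    qed
  qed (use l \<open>s \<ge> 2\<close> in auto)
  then have "card (uedges H) \<le> st n (theta_graph s (2 * l - 1))"
    using card_edges_le_st[OF H] by (simp add: H_def)
  moreover have "card (K \<times> ({..<m} \<rightarrow>\<^sub>E K) \<times> K) \<le> card (uedges H)"
  proof (rule card_inj_on_le)
    define P where "P = (\<lambda>(x :: 'a, p, y :: 'a). (True, x, p :: nat \<Rightarrow> 'a))"
    \<comment> \<open>The incidence equations solved for the coordinates of the line;
      \<open>restrict\<close> puts them into the extensional function space.\<close>
    define L where "L = (\<lambda>(x :: 'a, p, y). (False, y, restrict (\<lambda>j. hexagon_form j x y - p j) {..<m}))"
    have PV: "P z \<in> V" and LV: "L z \<in> V" and PL: "incident m (P z) (L z)" if zK: "z \<in> K \<times> ({..<m} \<rightarrow>\<^sub>E K) \<times> K" for z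
    proof -
      obtain x p y where z: "z = (x, p, y)" "x \<in> K" "p \<in> {..<m} \<rightarrow>\<^sub>E K" "y \<in> K"
        using zK by (cases z) auto
      have "p j \<in> K" if "j < m" for j using PiE_mem[OF z(3)] that by simp
      then have "hexagon_form j x y - p j \<in> K" if "j < m" for j
        using that K(2) hexagon_form_closed[OF K(3)] z(2,4) by blast
      then show "P z \<in> V" "L z \<in> V" "incident m (P z) (L z)"
        using z by (auto simp: P_def L_def V_def hexagon_verts_def incident_def)
    qed
    show "inj_on (\<lambda>z. {f (P z), f (L z)}) (K \<times> ({..<m} \<rightarrow>\<^sub>E K) \<times> K)"
    proof (rule inj_onI)
      fix z z' assume z: "z \<in> K \<times> ({..<m} \<rightarrow>\<^sub>E K) \<times> K" "z' \<in> K \<times> ({..<m} \<rightarrow>\<^sub>E K) \<times> K"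
        and eq: "{f (P z), f (L z)} = {f (P z'), f (L z')}"
      have "P z \<noteq> L z'" by (auto simp: P_def L_def split: prod.splits)
      then have "f (P z) \<noteq> f (L z')" using inj_onD[OF f(2)] PV[OF z(1)] LV[OF z(2)] by blast
      then have "f (P z) = f (P z')" "f (L z) = f (L z')" using eq by (auto simp: doubleton_eq_iff)
      then have "P z = P z'" "L z = L z'"
        using inj_onD[OF f(2) _ PV[OF z(1)] PV[OF z(2)]] inj_onD[OF f(2) _ LV[OF z(1)] LV[OF z(2)]] by simp_all
      then show "z = z'" by (cases z; cases z') (simp add: P_def L_def)
    qed
    show "(\<lambda>z. {f (P z), f (L z)}) ` (K \<times> ({..<m} \<rightarrow>\<^sub>E K) \<times> K) \<subseteq> uedges H"
    proof (rule image_subsetI)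
      fix z assume z: "z \<in> K \<times> ({..<m} \<rightarrow>\<^sub>E K) \<times> K"
      have "hexagon_adj K m (P z) (L z)"
        using PV[OF z] LV[OF z] PL[OF z] by (simp add: hexagon_adj_def V_def)
      then show "{f (P z), f (L z)} \<in> uedges H"
        unfolding H_def ugraph.simps by (intro CollectI exI[of _ "P z"] exI[of _ "L z"]) simp
    qed
    have "uedges H \<subseteq> Pow (uverts H)" "finite (uverts H)" using H by (auto simp: fin_simple_graph_def)
    then show "finite (uedges H)" by (auto intro: finite_subset)
  qed
  moreover have "card (K \<times> ({..<m} \<rightarrow>\<^sub>E K) \<times> K) = card K ^ (l + 1)"
    by (simp add: card_cartesian_product card_PiE l_eq)
  ultimately show ?thesis by simp
qed

lemma st_theta_lower:
  assumes l: "l \<in> {2, 3, 5}" and "s \<ge> 2"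
  shows "(\<lambda>n. real n powr (1 + 1 / real l)) \<in> O(\<lambda>n. real (st n (theta_graph s (2 * l - 1))))"
proof -
  have "l > 0" using l by auto
  have "norm (real n powr (1 + 1 / real l)) \<le> (4 * 3 ^ (l + 1)) * norm (real (st n (theta_graph s (2 * l - 1))))"
    if n: "n \<ge> 2 * 3 ^ l" for n
  proof -
    \<comment> \<open>With \<open>j = Suc i\<close>, \<open>q = 3 ^ i\<close> is the largest power
      of 3 such that \<open>2 * q ^ l \<le> n\<close>, hence \<open>n < 2 * (3 * q) ^ l\<close>.
      Passing from \<open>3 * q\<close> to \<open>q\<close> costs the factor
      \<open>3 ^ (l + 1)\<close>, and the leading 2 costs at most 4.\<close>
    define j where "j = (LEAST j. n < 2 * (3 ^ j) ^ l)"
    have "n < 3 ^ n" by (rule power_gt_expt) simp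
    also have "\<dots> \<le> (3 ^ n) ^ l" using \<open>l > 0\<close> by (intro self_le_power) auto
    finally have "n < 2 * (3 ^ n) ^ l" by simp
    then have j: "n < 2 * (3 ^ j) ^ l" unfolding j_def by (rule LeastI)
    have "(1 :: nat) \<le> 3 ^ l" by simp
    \<comment> \<open>The lower bound on \<open>n\<close> ensures \<open>i > 0\<close>, so that
      \<open>gf3_ext i\<close> is a field with \<open>3 ^ i\<close> elements.\<close>
    then have "2 * (3 ^ 0) ^ l \<le> n" "2 * (3 ^ 1) ^ l \<le> n" using n unfolding power_0 power_one power_one_right by linarith+
    then have "j \<noteq> 0" "j \<noteq> 1" using j by (metis not_le)+
    then obtain i where i: "j = Suc i" "i > 0" by (cases j) auto
    define q :: nat where "q = 3 ^ i"
    have "\<not> n < 2 * (3 ^ i) ^ l" using not_less_Least[of i "\<lambda>j. n < 2 * (3 ^ j) ^ l"] i(1) by (simp add: j_def)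
    then have "2 * q ^ l \<le> n" by (simp add: q_def)
    then have st: "q ^ (l + 1) \<le> st n (theta_graph s (2 * l - 1))"
      using card_power_le_st[OF three_eq_0_gf3_closure card_gf3_ext(1)[OF i(2)] gf3_ext_diff gf3_ext_mult l _ \<open>s \<ge> 2\<close>]
        card_gf3_ext(2)[OF i(2)] by (simp add: q_def)
    have "n \<le> 2 * (3 * q) ^ l" using j by (simp add: i(1) q_def)
    then have "real n \<le> 2 * real (3 * q) ^ l" by (metis of_nat_mono of_nat_mult of_nat_numeral of_nat_power)
    then have "real n powr (1 + 1 / real l) \<le> (2 * real (3 * q) ^ l) powr (1 + 1 / real l)"
      by (intro powr_mono2) auto
    also have "\<dots> = 2 powr (1 + 1 / real l) * (real (3 * q) ^ l) powr (1 + 1 / real l)"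
      by (rule powr_mult)
    also have "(real (3 * q) ^ l) powr (1 + 1 / real l) = real (3 * q) ^ (l + 1)"
    proof -
      have q0: "real (3 * q) > 0" by (simp add: q_def)
      have "(real (3 * q) ^ l) powr (1 + 1 / real l) = real (3 * q) powr (real l * (1 + 1 / real l))"
        unfolding powr_realpow[OF q0, symmetric] powr_powr ..
      also have "real l * (1 + 1 / real l) = real (l + 1)" using \<open>l > 0\<close> by (simp add: field_simps)
      finally show ?thesis using q0 powr_realpow by metis
    qed
    also have "2 powr (1 + 1 / real l) \<le> (2 :: real) powr 2" using \<open>l > 0\<close> by (intro powr_mono) auto
    then have "2 powr (1 + 1 / real l) * real (3 * q) ^ (l + 1) \<le> 4 * real (3 * q) ^ (l + 1)"
      by (intro mult_right_mono) auto
    also have "\<dots> = 4 * 3 ^ (l + 1) * real (q ^ (l + 1))" by (simp add: power_mult_distrib)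
    also have "\<dots> \<le> 4 * 3 ^ (l + 1) * real (st n (theta_graph s (2 * l - 1)))"
      using st by (intro mult_left_mono of_nat_mono) auto
    finally show ?thesis by simp
  qed
  then show ?thesis by (intro bigoI eventually_sequentiallyI)
qed

theorem theorem21:
  fixes s :: nat
  assumes "s \<ge> 2"
  shows "(\<lambda>n. real (st n (theta_graph s 3))) \<in> \<Theta>(\<lambda>n. real n powr (3/2)) \<and>
         (\<lambda>n. real (st n (theta_graph s 5))) \<in> \<Theta>(\<lambda>n. real n powr (4/3)) \<and>
         (\<lambda>n. real (st n (theta_graph s 9))) \<in> \<Theta>(\<lambda>n. real n powr (6/5))"
proof -
  have *: "(\<lambda>n. real (st n (theta_graph s (2 * l - 1)))) \<in> \<Theta>(\<lambda>n. real n powr (1 + 1 / real l))"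
    if "l \<in> {2, 3, 5}" for l
    using st_theta_upper[of l s] st_theta_lower[OF that assms] that assms
    by (auto simp: bigtheta_def bigomega_iff_bigo)
  show ?thesis using *[of 2] *[of 3] *[of 5] by simp
qed

end
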